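(* Let $g$ be a nonzero function in the Feichtinger algebra $M^1(\mathbb R^d)$. Suppose that $M\subseteq L^2(\mathbb R^d)$ is a closed subspace containing $\{e^{2\pi i b\cdot x}g(x)\}_{b\in\Gamma}$ for some infinite uniformly discrete subset $\Gamma\subseteq\mathbb R^d$. Then $M$ does not admit any unconditional Schauder frame consisting of translates of finitely many functions; that is, there are no $N\in\mathbb N$, functions $g_1,\dots,g_N\in L^2(\mathbb R^d)$ and countable sets $\Lambda_1,\dots,\Lambda_N\subseteq\mathbb R^d$ such that $\{g_i(\cdot-a)\,:\,a\in\Lambda_i,\ 1\le i\le N\}$ is an unconditional Schauder frame for $M$.
   Context: A set $\Gamma\subseteq\mathbb R^d$ is uniformly discrete if there is $\delta>0$ with $\|a-b\|\ge\delta$ for any two distinct $a,b\in\Gamma$. For a function $f$ on $\mathbb R^d$ and $a,b\in\mathbb R^d$, $(T_af)(x)=f(x-a)$ and $(M_bf)(x)=e^{2\pi i b\cdot x}f(x)$. Fix a nonzero Schwartz function $\psi$ on $\mathbb R^d$. The short-time Fourier transform of $f\in L^2(\mathbb R^d)$ is $V_\psi f(x,w)=\langle f,M_wT_x\psi\rangle$, $(x,w)\in\mathbb R^{2d}$. The Feichtinger algebra is $M^1(\mathbb R^d)=\{f\in L^2(\mathbb R^d):\|V_\psi f\|_{L^1(\mathbb R^{2d})}<\infty\}$. A countable family $\{x_n\}_{n}$ in a Hilbert space $K$ (here $K=M$ with the $L^2$ inner product, so the family must lie in $M$) is an unconditional Schauder frame for $K$ if there exists a family $\{y_n\}_{n}\subseteq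 K$ such that $x=\sum_n\langle x,y_n\rangle x_n$ for all $x\in K$, with unconditional convergence in norm. *)

theory Defs
  imports "HOL-Analysis.Analysis"
begin

text \<open>
  Elements of \<open>L\<^sup>2\<close> are Borel representatives of their almost-everywhere classes. Every Lebesgue
  measurable function agrees almost everywhere with a Borel function, so no class is lost; equality
  in \<open>L\<^sup>2\<close> is equality almost everywhere, i.e. \<open>L2_norm (f - g) = 0\<close>.
\<close>

definition L2 :: "('a::euclidean_space \<Rightarrow> complex) set" where
  "L2 = {f. f \<in> borel_measurable lborel \<and> integrable lborel (\<lambda>x. (cmod (f x))\<^sup>2)}"

definition L2_inner :: "('a::euclidean_space \<Rightarrow> complex) \<Rightarrow> ('a \<Rightarrow> complex) \<Rightarrow> complex" where
  "L2_inner f g = (LINT x|lborel. f x * cnj (g x))"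

definition L2_norm :: "('a::euclidean_space \<Rightarrow> complex) \<Rightarrow> real" where
  "L2_norm f = sqrt (LINT x|lborel. (cmod (f x))\<^sup>2)"

text \<open>
  Sequential closedness under \<open>L2_norm\<close> also makes a closed subspace invariant under changing
  a member on a null set, so that it is a union of almost-everywhere classes.
\<close>

definition closed_L2_subspace :: "('a::euclidean_space \<Rightarrow> complex) set \<Rightarrow> bool" where
  "closed_L2_subspace M \<longleftrightarrow>
     M \<subseteq> L2 \<and>
     (\<lambda>x. 0) \<in> M \<and>
     (\<forall>f\<in>M. \<forall>g\<in>M. (\<lambda>x. f x + g x) \<in> M) \<and>
     (\<forall>c. \<forall>f\<in>M. (\<lambda>x. c * f x) \<in> M) \<and>
     (\<forall>F. \<forall>f\<in>L2. (\<forall>n::nat. F n \<in> M) \<and> (\<lambda>n. L2_norm (\<lambda>x. F n x - f x)) \<longlonglongrightarrow> 0 \<longrightarrow> f \<in> M)"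

definition translation :: "'a::euclidean_space \<Rightarrow> ('a \<Rightarrow> complex) \<Rightarrow> 'a \<Rightarrow> complex" where
  "translation a f = (\<lambda>x. f (x - a))"

definition modulation :: "'a::euclidean_space \<Rightarrow> ('a \<Rightarrow> complex) \<Rightarrow> 'a \<Rightarrow> complex" where
  "modulation b f = (\<lambda>x. exp (2 * complex_of_real pi * \<i> * complex_of_real (b \<bullet> x)) * f x)"

text \<open>
  A multi-index is given as a list of coordinate directions; the iterated partial derivative is
  meaningful because \<open>schwartz\<close> requires differentiability at every stage.
\<close>

fun iterated_partial :: "'a::euclidean_space list \<Rightarrow> ('a \<Rightarrow> complex) \<Rightarrow> 'a \<Rightarrow> complex" where
  "iterated_partial [] f = f"
| "iterated_partial (b # bs) f = (\<lambda>x. frechet_derivative (iterated_partial bs f) (at x) b)"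

definition schwartz :: "('a::euclidean_space \<Rightarrow> complex) \<Rightarrow> bool" where
  "schwartz f \<longleftrightarrow>
     (\<forall>bs. set bs \<subseteq> Basis \<longrightarrow>
        (\<forall>x. iterated_partial bs f differentiable at x) \<and>
        (\<forall>k::nat. \<exists>C. \<forall>x. norm x ^ k * cmod (iterated_partial bs f x) \<le> C))"

definition STFT :: "('a::euclidean_space \<Rightarrow> complex) \<Rightarrow> ('a \<Rightarrow> complex) \<Rightarrow> 'a \<times> 'a \<Rightarrow> complex" where
  "STFT \<psi> f = (\<lambda>(x, w). L2_inner f (modulation w (translation x \<psi>)))"

text \<open>
  For \<open>f\<close> in \<open>L2\<close> and a Schwartz window the transform is continuous, hence measurable, so
  integrability says exactly that its \<open>L\<^sup>1\<close> norm is finite. The space does not depend on the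
  choice of the nonzero Schwartz window.
\<close>

definition feichtinger_algebra ::
  "('a::euclidean_space \<Rightarrow> complex) \<Rightarrow> ('a \<Rightarrow> complex) set" where
  "feichtinger_algebra \<psi> = {f \<in> L2. integrable lborel (STFT \<psi> f)}"

text \<open>
  Unconditional convergence of \<open>\<Sum>i\<in>I. u i\<close> to \<open>f\<close> in \<open>L\<^sup>2\<close>: this is \<^const>\<open>has_sum\<close>,
  i.e. convergence of the net of finite partial sums, with respect to the seminorm \<open>L2_norm\<close>.
\<close>

definition L2_has_sum ::
  "('i \<Rightarrow> 'a::euclidean_space \<Rightarrow> complex) \<Rightarrow> ('a \<Rightarrow> complex) \<Rightarrow> 'i set \<Rightarrow> bool" where
  "L2_has_sum u f I \<longleftrightarrow>
     ((\<lambda>F. L2_norm (\<lambda>t. (\<Sum>i\<in>F. u i t) - f t)) \<longlongrightarrow> 0) (finite_subsets_at_top I)"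

definition unconditional_schauder_frame ::
  "('a::euclidean_space \<Rightarrow> complex) set \<Rightarrow> 'i set \<Rightarrow> ('i \<Rightarrow> 'a \<Rightarrow> complex) \<Rightarrow> bool" where
  "unconditional_schauder_frame K I x \<longleftrightarrow>
     countable I \<and> (\<forall>i\<in>I. x i \<in> K) \<and>
     (\<exists>y. (\<forall>i\<in>I. y i \<in> K) \<and>
          (\<forall>f\<in>K. L2_has_sum (\<lambda>i t. L2_inner f (y i) * x i t) f I))"

end

theory Submission
  imports Defs "HOL-Probability.Characteristic_Functions" "HOL-Probability.Sinc_Integral"
begin

text \<open>
  Suppose the translates \<open>x\<^sub>j\<close> of \<open>h\<^sub>1, \<dots>, h\<^sub>N\<close> form an unconditional frame with dual family \<open>y\<^sub>j\<close>.
  Cut the space into cubes \<open>Q\<close> so small that translates of \<open>h\<^sub>i\<close> by points of the same cube are almost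
  parallel. For \<open>f\<close> in \<open>M\<close> all subset sums of \<open>\<Sum> \<langle>f, y\<^sub>j\<rangle> x\<^sub>j\<close> are bounded, so a choice of signs over the
  cubes bounds \<open>\<Sum>\<^sub>Q (\<Sum> \<bar>\<langle>f, y\<^sub>j\<rangle>\<bar>)\<^sup>2\<close>, where the inner sum runs over the translations in \<open>Q\<close>. A gliding
  hump makes the bound uniform over the modulations \<open>f = M\<^sub>b g\<close>, \<open>b \<in> \<Gamma>\<close>.

  Since \<open>V g\<close> is integrable, \<open>g\<close> belongs to the Wiener amalgam space of locally bounded functions
  with summable local suprema. Young's inequality then gives a square-summable majorant, independent
  of \<open>b\<close>, of \<open>E\<^sub>b(Q) = sup {\<bar>\<langle>T\<^sub>a h\<^sub>i, M\<^sub>b g\<rangle>\<bar> : a \<in> Q}\<close>. Each \<open>E\<^sub>b(Q)\<close> tends to 0 as \<open>b\<close> tends to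
  infinity, by the Riemann--Lebesgue lemma, hence so does \<open>\<Sum>\<^sub>Q E\<^sub>b(Q)\<^sup>2\<close>. By Cauchy--Schwarz
  \<open>\<parallel>g\<parallel>\<^sup>2 = \<Sum> \<langle>M\<^sub>b g, y\<^sub>j\<rangle> \<langle>x\<^sub>j, M\<^sub>b g\<rangle>\<close> tends to 0 along \<open>\<Gamma>\<close>, which is unbounded: a contradiction.
\<close>

section \<open>Translations and the Riemann--Lebesgue lemma\<close>

text \<open>One cube may contain arbitrarily many of the given translations, so an l^2 bound on the
  coefficients would be too weak. What survives crowding is the mixed norm that is l^1 inside a cube
  and l^2 over the cubes; its dual partner is the supremum inside a cube followed by l^2. Translates
  of one cube with coefficients in a common sector of the plane cannot cancel, which produces the
  l^1 part.

  Integrability of V g enters slice by slice: for fixed x, the function w \<mapsto> V g(x, w) is the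
  Fourier transform of g times the conjugate translated window, and the L^1 norm of a Fourier
  transform bounds the function itself.

  The dual family is only known to lie in M, with no control on its norms. Each f therefore comes
  with its own bound on subset sums, and the gliding hump replaces these bounds by a common one for
  all modulations of g.

  All estimates are uniform over finite sets of translations, because the frequency b has to be
  fixed before the expansion of the modulated function is truncated.\<close>

lemma lborel_distr_minus: "distr lborel borel (\<lambda>x. x - a) = (lborel :: 'a::euclidean_space measure)"
proof -
  have "(\<lambda>x. x - a) = (+) (- a)" by auto
  then show ?thesis using lborel_distr_plus[of "-a"] by simp
qed

lemma nn_integral_lborel_shift:
  fixes a :: "'a::euclidean_space"
  assumes [measurable]: "f \<in> borel_measurable borel"
  shows "(\<integral>\<^sup>+x. f (x - a) \<partial>lborel) = (\<integral>\<^sup>+x. f x \<partial>lborel)"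
  by (subst (2) lborel_distr_minus[of a, symmetric]) (simp add: nn_integral_distr)

lemma integrable_lborel_shift:
  fixes a :: "'a::euclidean_space" and f :: "'a \<Rightarrow> 'b::{banach, second_countable_topology}"
  assumes "integrable lborel f"
  shows "integrable lborel (\<lambda>x. f (x - a))"
proof -
  have "integrable (distr lborel borel (\<lambda>x. x - a)) f"
    using assms by (simp add: lborel_distr_minus)
  then show ?thesis
    by (subst (asm) integrable_distr_eq) (use assms in auto)
qed

lemma integral_lborel_shift:
  fixes a :: "'a::euclidean_space" and f :: "'a \<Rightarrow> 'b::{banach, second_countable_topology}"
  assumes [measurable]: "f \<in> borel_measurable borel"
  shows "(\<integral>x. f (x - a) \<partial>lborel) = (\<integral>x. f x \<partial>lborel)"
  by (subst (2) lborel_distr_minus[of a, symmetric]) (simp add: integral_distr)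

text \<open>Regularity squeezes \<open>A\<close> between a compact \<open>S\<close> and an open
  \<open>U\<close>. A shift shorter than the distance from \<open>S\<close> to the complement of
  \<open>U\<close> moves \<open>S\<close> within \<open>U\<close>, so the two indicators differ only
  on the layers \<open>A - S\<close> and \<open>U - A\<close> and on their shifts. Four layers of
  measure at most \<open>e/4\<close> give \<open>e\<close>.\<close>

lemma indicator_translation_continuous_L1:
  fixes A :: "'a::euclidean_space set"
  assumes A: "A \<in> sets borel" "emeasure lborel A < \<infinity>" and e: "e > 0"
  shows "\<exists>d>0. \<forall>a. norm a < d \<longrightarrow>
     (\<integral>x. \<bar>indicator A (x - a) - indicator A x\<bar> \<partial>lborel) \<le> (e::real)"
proof -
  have AL: "A \<in> sets lebesgue" using A by auto
  have fA: "A \<in> lmeasurable" using A by (intro fmeasurableI) auto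
  obtain U where U: "open U" "A \<subseteq> U" "U - A \<in> lmeasurable" "emeasure lebesgue (U - A) < ennreal (e/4)"
    using sets_lebesgue_outer_open[OF AL, of "e/4"] e by auto
  obtain T where T: "closed T" "T \<subseteq> A" "A - T \<in> lmeasurable" "emeasure lebesgue (A - T) < ennreal (e/8)"
    using sets_lebesgue_inner_closed[OF AL, of "e/8"] e by auto
  have fT: "emeasure lborel T < \<infinity>"
    using A emeasure_mono[OF T(2), of lborel] by (simp add: le_less_trans)
  \<comment> \<open>The closed inner approximation \<open>T\<close> may be unbounded. Cutting it
    with a large ball costs another \<open>e/8\<close> and gives the compactness that a positive
    distance to the complement of \<open>U\<close> requires.\<close>
  obtain S where S: "compact S" "S \<subseteq> T" "emeasure lborel (T - S) < ennreal (e/8)"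
  proof -
    have "(\<lambda>n. emeasure lborel (T - cball 0 (real n))) \<longlonglongrightarrow> emeasure lborel (\<Inter>n. T - cball 0 (real n))"
    proof (rule Lim_emeasure_decseq)
      show "range (\<lambda>n. T - cball 0 (real n)) \<subseteq> sets lborel" using T by auto
      show "decseq (\<lambda>n. T - cball 0 (real n))" by (auto simp: decseq_def)
      show "emeasure lborel (T - cball 0 (real n)) \<noteq> \<infinity>" for n
        using fT by (metis Diff_subset T(1) borel_closed emeasure_mono infinity_ennreal_def
            neq_top_trans order_less_irrefl sets_lborel)
    qed
    moreover have "(\<Inter>n. T - cball 0 (real n)) = {}"
      using real_arch_simple by (auto simp: dist_norm)
    ultimately have "(\<lambda>n. emeasure lborel (T - cball 0 (real n))) \<longlonglongrightarrow> 0"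
      by (simp del: INT_simps)
    then have "eventually (\<lambda>n. emeasure lborel (T - cball 0 (real n)) < ennreal (e/8)) sequentially"
      by (rule order_tendstoD) (use e in auto)
    then obtain n where n: "emeasure lborel (T - cball 0 (real n)) < ennreal (e/8)"
      by (auto simp: eventually_sequentially)
    have "T - (T \<inter> cball 0 (real n)) = T - cball 0 (real n)" by auto
    with n T show ?thesis
      by (intro that[of "T \<inter> cball 0 (real n)"]) (auto intro: closed_Int_compact)
  qed
  have SU: "S \<subseteq> U" using S T U by auto
  obtain d where d: "d > 0" "\<And>x y. x \<in> S \<Longrightarrow> dist x y < d \<Longrightarrow> y \<in> U"
  proof (cases "S = {}")
    case True then show ?thesis using that[of 1] by auto
  next
    case False
    have "S \<inter> (-U) = {}" using SU by auto
    then obtain d where d: "d > 0" "\<forall>x\<in>S. \<forall>y\<in>-U. d \<le> dist x y"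
      using separate_compact_closed[of S "-U"] S U by auto
    then show ?thesis using that[of d] by force
  qed
  have [measurable]: "A \<in> sets borel" "U \<in> sets borel" "T \<in> sets borel" "S \<in> sets borel"
    using A U T S by (auto intro: borel_open borel_closed borel_compact)
  have eU: "emeasure lborel (U - A) < ennreal (e/4)"
    using U(4) by (simp add: emeasure_completion)
  have eT: "emeasure lborel (A - T) < ennreal (e/8)"
    using T(4) by (simp add: emeasure_completion)
  have "emeasure lborel (A - S) \<le> emeasure lborel (A - T) + emeasure lborel (T - S)"
    using emeasure_subadditive[of "A - T" lborel "T - S"] 
    by (rule order_trans[rotated]) (auto intro!: emeasure_mono)
  also have "\<dots> \<le> ennreal (e/8) + ennreal (e/8)"
    using eT S by (intro add_mono) auto
  finally have eS: "emeasure lborel (A - S) \<le> ennreal (e/4)"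
    using e by (simp flip: ennreal_plus)
  show ?thesis
  proof (intro exI[of _ d] conjI allI impI)
    fix a :: 'a assume a: "norm a < d"
    have pw: "ennreal \<bar>indicator A (x - a) - indicator A x\<bar> \<le>
       (indicator (A - S) (x - a) + indicator (U - A) x) +
       (indicator (A - S) x + indicator (U - A) (x - a) :: ennreal)" for x
    proof -
      have "x - a \<in> S \<Longrightarrow> x \<in> U" using d(2)[of "x - a" x] a by (simp add: dist_norm norm_minus_commute)
      moreover have "x \<in> S \<Longrightarrow> x - a \<in> U" using d(2)[of x "x - a"] a by (simp add: dist_norm)
      ultimately show ?thesis using T S by (auto simp: indicator_def)
    qed
    have sh: "(\<integral>\<^sup>+x. indicator (A - S) (x - a) \<partial>lborel) = emeasure lborel (A - S)"
       "(\<integral>\<^sup>+x. indicator (U - A) (x - a) \<partial>lborel) = emeasure lborel (U - A)"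
      by (subst nn_integral_lborel_shift, auto)+
    have "(\<integral>\<^sup>+x. ennreal \<bar>indicator A (x - a) - indicator A x\<bar> \<partial>lborel) \<le>
      (\<integral>\<^sup>+x. (indicator (A - S) (x - a) + indicator (U - A) x) +
       (indicator (A - S) x + indicator (U - A) (x - a) :: ennreal) \<partial>lborel)"
      by (intro nn_integral_mono pw)
    also have "\<dots> = (emeasure lborel (A - S) + emeasure lborel (U - A)) + (emeasure lborel (A - S) + emeasure lborel (U - A))"
      by (simp add: nn_integral_add sh)
    also have "\<dots> \<le> (ennreal (e/4) + ennreal (e/4)) + (ennreal (e/4) + ennreal (e/4))"
      using eU eS by (intro add_mono) auto
    also have "\<dots> = ennreal e" using e by (simp flip: ennreal_plus)
    finally have le: "(\<integral>\<^sup>+x. ennreal \<bar>indicator A (x - a) - indicator A x\<bar> \<partial>lborel) \<le> ennreal e" .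
    show "(\<integral>x. \<bar>indicator A (x - a) - indicator A x\<bar> \<partial>lborel) \<le> (e::real)"
      using le e by (subst integral_eq_nn_integral) (auto intro!: enn2real_leI)
  qed (use d in auto)
qed

text \<open>Approximation by simple functions: indicators are the base case, and the limit case is
  an \<open>e/3\<close> argument in which translation invariance makes the error of the shifted
  approximant equal to that of the unshifted one.\<close>

lemma translation_continuous_L1:
  fixes f :: "'a::euclidean_space \<Rightarrow> 'b::{banach, second_countable_topology}"
  assumes "integrable lborel f" "e > 0"
  shows "\<exists>d>0. \<forall>a. norm a < d \<longrightarrow> (\<integral>x. norm (f (x - a) - f x) \<partial>lborel) \<le> e"
  using assms
proof (induction arbitrary: e rule: integrable_induct)
  case (base A c)
  obtain d where d: "d > 0" "\<And>a. norm a < d \<Longrightarrow>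
     (\<integral>x. \<bar>indicator A (x - a) - indicator A x\<bar> \<partial>lborel) \<le> e / (norm c + 1)"
    using indicator_translation_continuous_L1[of A "e / (norm c + 1)"] base
    by (auto simp: add_nonneg_pos)
  show ?case
  proof (intro exI[of _ d] conjI allI impI)
    fix a :: 'a assume a: "norm a < d"
    have "(\<integral>x. norm (indicator A (x - a) *\<^sub>R c - indicator A x *\<^sub>R c) \<partial>lborel) =
       (\<integral>x. \<bar>indicator A (x - a) - indicator A x\<bar> \<partial>lborel) * norm c"
      by (simp flip: scaleR_diff_left)
    also have "\<dots> \<le> e / (norm c + 1) * norm c"
      by (intro mult_right_mono d a) auto
    also have "\<dots> \<le> e" using base(3) by (simp add: divide_simps add_nonneg_pos mult_le_cancel_left_pos)
    finally show "(\<integral>x. norm (indicator A (x - a) *\<^sub>R c - indicator A x *\<^sub>R c) \<partial>lborel) \<le> e" .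
  qed (use d in auto)
next
  case (add f g)
  obtain d1 where d1: "d1 > 0" "\<And>a. norm a < d1 \<Longrightarrow> (\<integral>x. norm (f (x - a) - f x) \<partial>lborel) \<le> e/2"
    using add(3)[of "e/2"] add(5) by auto
  obtain d2 where d2: "d2 > 0" "\<And>a. norm a < d2 \<Longrightarrow> (\<integral>x. norm (g (x - a) - g x) \<partial>lborel) \<le> e/2"
    using add(4)[of "e/2"] add(5) by auto
  show ?case
  proof (intro exI[of _ "min d1 d2"] conjI allI impI)
    fix a :: 'a assume a: "norm a < min d1 d2"
    note i = add(1,2) integrable_lborel_shift[OF add(1), of a] integrable_lborel_shift[OF add(2), of a]
    have "(\<integral>x. norm (f (x - a) + g (x - a) - (f x + g x)) \<partial>lborel) \<le> 
      (\<integral>x. norm (f (x - a) - f x) + norm (g (x - a) - g x) \<partial>lborel)"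
      using i by (intro integral_mono) (auto simp: add_diff_add norm_triangle_ineq)
    also have "\<dots> = (\<integral>x. norm (f (x - a) - f x) \<partial>lborel) + (\<integral>x. norm (g (x - a) - g x) \<partial>lborel)"
      using i by (intro Bochner_Integration.integral_add) auto
    also have "\<dots> \<le> e" using d1(2)[of a] d2(2)[of a] a by auto
    finally show "(\<integral>x. norm (f (x - a) + g (x - a) - (f x + g x)) \<partial>lborel) \<le> e" .
  qed (use d1 d2 in auto)
next
  case (lim f s)
  have "(\<lambda>i. \<integral>x. norm (s i x - f x) \<partial>lborel) \<longlonglongrightarrow> (\<integral>x. 0 \<partial>(lborel :: 'a measure))"
  \<comment> \<open>The induction rule supplies approximants with norm at most
    \<open>2 * norm (f x)\<close>; the distance to \<open>f x\<close> adds one more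
    \<open>norm (f x)\<close>.\<close>
  proof (rule integral_dominated_convergence[where w = "\<lambda>x. 3 * norm (f x)"])
    show "AE x in lborel. (\<lambda>i. norm (s i x - f x)) \<longlonglongrightarrow> 0"
      using lim by (intro AE_I2 tendsto_norm_zero LIM_zero) auto
    show "AE x in lborel. norm (norm (s i x - f x)) \<le> 3 * norm (f x)" for i
      using lim.hyps(3)[of _ i] norm_triangle_ineq4[of "s i _" "f _"] by (intro AE_I2) (smt (verit) UNIV_I real_norm_def norm_ge_zero space_borel space_lborel)
  qed (use lim in auto)
  then have "\<forall>\<^sub>F i in sequentially. (\<integral>x. norm (s i x - f x) \<partial>lborel) < e/3"
    using lim.prems by (intro order_tendstoD(2)) auto
  then obtain i where i: "(\<integral>x. norm (s i x - f x) \<partial>lborel) < e/3"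
    by (auto simp: eventually_sequentially)
  obtain d where d: "d > 0" "\<And>a. norm a < d \<Longrightarrow> (\<integral>x. norm (s i (x - a) - s i x) \<partial>lborel) \<le> e/3"
    using lim.IH[of "e/3" i] lim.prems by auto
  show ?case
  proof (intro exI[of _ d] conjI allI impI)
    fix a :: 'a assume a: "norm a < d"
    note [measurable] = lim.hyps(1)[THEN borel_measurable_integrable] lim.hyps(4)[THEN borel_measurable_integrable]
    note I = lim.hyps(4) lim.hyps(1)[of i] integrable_lborel_shift[OF lim.hyps(4), of a] integrable_lborel_shift[OF lim.hyps(1), of i a]
    have sh: "(\<integral>x. norm (s i (x - a) - f (x - a)) \<partial>lborel) = (\<integral>x. norm (s i x - f x) \<partial>lborel)"
      by (subst integral_lborel_shift[where f="\<lambda>x. norm (s i x - f x)"]) auto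
    have "(\<integral>x. norm (f (x - a) - f x) \<partial>lborel) \<le> 
      (\<integral>x. norm (s i (x - a) - f (x - a)) + (norm (s i (x - a) - s i x) + norm (s i x - f x)) \<partial>lborel)"
    proof (rule integral_mono)
      show "norm (f (x - a) - f x) \<le> norm (s i (x - a) - f (x - a)) + (norm (s i (x - a) - s i x) + norm (s i x - f x))" for x
        using norm_triangle_ineq4[of "s i (x-a) - f x" "s i (x - a) - f (x - a)"]
         norm_triangle_ineq[of "s i (x-a) - s i x" "s i x - f x"] by (auto simp: algebra_simps)
    qed (use I in auto)
    also have "\<dots> = (\<integral>x. norm (s i (x - a) - f (x - a)) \<partial>lborel) + ((\<integral>x. norm (s i (x - a) - s i x) \<partial>lborel)
       + (\<integral>x. norm (s i x - f x) \<partial>lborel))"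
      using I by (subst Bochner_Integration.integral_add, auto)+
    also have "\<dots> \<le> e" using i d(2)[OF a] sh by auto
    finally show "(\<integral>x. norm (f (x - a) - f x) \<partial>lborel) \<le> e" .
  qed (use d in auto)
qed

lemma borel_measurable_cis [measurable]: "cis \<in> borel_measurable borel"
  by (intro borel_measurable_continuous_onI continuous_intros)

text \<open>A shift by half a wavelength flips the sign of the exponential. Averaging the integral
  with its shifted form leaves half the L^1 distance between \<open>f\<close> and its translate, and
  the half wavelength shrinks as \<open>b\<close> grows.\<close>

lemma Riemann_Lebesgue:
  fixes f :: "'a::euclidean_space \<Rightarrow> complex"
  assumes f: "integrable lborel f" and e: "e > 0"
  shows "\<exists>R. \<forall>b. norm b > R \<longrightarrow> cmod (\<integral>x. f x * cis (- (2 * pi * (b \<bullet> x))) \<partial>lborel) \<le> e"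
proof -
  obtain d where d: "d > 0" "\<And>a. norm a < d \<Longrightarrow> (\<integral>x. norm (f (x - a) - f x) \<partial>lborel) \<le> e"
    using translation_continuous_L1[OF f e] by auto
  note [measurable] = f[THEN borel_measurable_integrable]
  show ?thesis
  proof (intro exI[of _ "1/d"] allI impI)
    fix b :: 'a assume b: "norm b > 1 / d"
    then have b0: "norm b > 0" using d by (auto intro: less_trans[rotated])
    \<comment> \<open>The multiple of \<open>b\<close> with \<open>b \<bullet> a = 1/2\<close>; its
      length \<open>1 / (2 * norm b)\<close> is below \<open>d\<close> as soon as
      \<open>norm b > 1/d\<close>.\<close>
    define a where "a = (1 / (2 * (norm b)\<^sup>2)) *\<^sub>R b"
    have na: "norm a = 1 / (2 * norm b)" using b0 by (simp add: a_def power2_eq_square)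
    have a: "norm a < d"
    proof -
      have "1 / norm b < d" using b b0 d by (simp add: field_simps)
      then show ?thesis unfolding na using b0 by (simp add: field_simps) 
    qed
    have ba: "b \<bullet> a = 1/2" using b0 by (simp add: a_def power2_norm_eq_inner)
    let ?h = "\<lambda>x. f x * cis (- (2 * pi * (b \<bullet> x)))"
    have ih: "integrable lborel ?h"
      by (rule Bochner_Integration.integrable_bound[OF f]) (auto simp: norm_mult)
    have "(\<integral>x. ?h x \<partial>lborel) = (\<integral>x. ?h (x - a) \<partial>lborel)"
      by (subst integral_lborel_shift[where f = ?h]) auto
    also have "\<dots> = (\<integral>x. - (f (x - a) * cis (- (2 * pi * (b \<bullet> x)))) \<partial>lborel)"
    proof (rule Bochner_Integration.integral_cong[OF refl])
      fix x
      have "cis (- (2 * pi * (b \<bullet> (x - a)))) = cis (- (2 * pi * (b \<bullet> x)) + pi)"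
        by (simp add: inner_diff_right ba algebra_simps)
      also have "\<dots> = - cis (- (2 * pi * (b \<bullet> x)))"
        by (simp add: complex_eq_iff)
      finally show "?h (x - a) = - (f (x - a) * cis (- (2 * pi * (b \<bullet> x))))" by simp
    qed
    finally have eq: "(\<integral>x. ?h x \<partial>lborel) = (\<integral>x. - (f (x - a) * cis (- (2 * pi * (b \<bullet> x)))) \<partial>lborel)" .
    have i2: "integrable lborel (\<lambda>x. - (f (x - a) * cis (- (2 * pi * (b \<bullet> x)))))"
      by (rule Bochner_Integration.integrable_bound[OF integrable_lborel_shift[OF f, of a]]) (auto simp: norm_mult)
    have "2 * (\<integral>x. ?h x \<partial>lborel) = (\<integral>x. ?h x \<partial>lborel) + (\<integral>x. - (f (x - a) * cis (- (2 * pi * (b \<bullet> x)))) \<partial>lborel)"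
      using eq by simp
    also have "\<dots> = (\<integral>x. ?h x + - (f (x - a) * cis (- (2 * pi * (b \<bullet> x)))) \<partial>lborel)"
      by (rule Bochner_Integration.integral_add[symmetric, OF ih i2])
    finally have "cmod (2 * (\<integral>x. ?h x \<partial>lborel)) \<le> (\<integral>x. norm (?h x + - (f (x - a) * cis (- (2 * pi * (b \<bullet> x))))) \<partial>lborel)"
      by simp
    also have "\<dots> = (\<integral>x. norm (f (x - a) - f x) \<partial>lborel)"
    proof (rule Bochner_Integration.integral_cong[OF refl])
      fix x
      have "?h x + - (f (x - a) * cis (- (2 * pi * (b \<bullet> x)))) = (f x - f (x - a)) * cis (- (2 * pi * (b \<bullet> x)))"
        by (simp add: algebra_simps)
      then show "norm (?h x + - (f (x - a) * cis (- (2 * pi * (b \<bullet> x))))) = norm (f (x - a) - f x)"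
        by (simp add: norm_mult norm_minus_commute)
    qed
    also have "\<dots> \<le> e" by (rule d a)+
    finally show "cmod (\<integral>x. ?h x \<partial>lborel) \<le> e" using e by (simp add: norm_mult)
  qed
qed

section \<open>The Fourier transform bounds a function\<close>

lemma
  fixes f :: "'a::euclidean_space \<Rightarrow> real \<Rightarrow> 'b::{real_normed_field, banach, second_countable_topology}"
  assumes f: "\<And>b. b \<in> Basis \<Longrightarrow> integrable lborel (f b)"
  shows integrable_lborel_prod_Basis: "integrable lborel (\<lambda>x::'a. \<Prod>b\<in>Basis. f b (x \<bullet> b))" (is ?I)
    and integral_lborel_prod_Basis:
      "(\<integral>x. (\<Prod>b\<in>Basis. f b (x \<bullet> b)) \<partial>lborel) = (\<Prod>b\<in>Basis. \<integral>x. f b x \<partial>lborel)" (is ?E)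
proof -
  interpret product_sigma_finite "\<lambda>_::'a. lborel :: real measure" ..
  have [measurable]: "f b \<in> borel_measurable borel" if "b \<in> Basis" for b
    using f[OF that] by (auto dest: borel_measurable_integrable)
  have m: "(\<lambda>g. \<Sum>b\<in>Basis. g b *\<^sub>R b) \<in> (\<Pi>\<^sub>M b\<in>(Basis::'a set). lborel :: real measure) \<rightarrow>\<^sub>M borel"
    by measurable
  have *: "(\<Prod>b\<in>Basis. f b ((\<Sum>b\<in>Basis. g b *\<^sub>R b) \<bullet> b)) = (\<Prod>b\<in>Basis. f b (g b))" for g
    by (intro prod.cong) auto
  show ?I
    by (subst lborel_eq, subst integrable_distr_eq)
      (use m f in \<open>auto simp: * intro!: product_integrable_prod\<close>)
  show ?E
    by (subst lborel_eq, subst integral_distr)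
      (use m f in \<open>auto simp: * intro!: product_integral_prod\<close>)
qed

lemma
  fixes f :: "'a::euclidean_space \<Rightarrow> 'b::{banach, second_countable_topology}"
  assumes f: "integrable lborel f" and c: "c \<noteq> 0"
  shows integrable_lborel_affine: "integrable lborel (\<lambda>x. f (t + c *\<^sub>R x))" (is ?I)
    and integral_lborel_affine:
      "(\<integral>x. f x \<partial>lborel) = \<bar>c\<bar> ^ DIM('a) *\<^sub>R (\<integral>x. f (t + c *\<^sub>R x) \<partial>lborel)" (is ?E)
proof -
  have [measurable]: "f \<in> borel_measurable borel" using f by (auto dest: borel_measurable_integrable)
  have "integrable (density (distr lborel borel (\<lambda>x. t + c *\<^sub>R x)) (\<lambda>_. ennreal (\<bar>c\<bar>^DIM('a)))) f"
    using f lborel_affine[OF c, of t] by (simp add: ennreal_power)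
  then have "integrable lborel (\<lambda>x. \<bar>c\<bar> ^ DIM('a) *\<^sub>R f (t + c *\<^sub>R x))"
    by (subst (asm) integrable_density, simp, simp, simp)
       (subst (asm) integrable_distr_eq, auto)
  from integrable_scaleR_right[OF this, of "1 / \<bar>c\<bar> ^ DIM('a)"] c show ?I by simp
  show ?E
    by (subst lborel_affine[OF c, of t]) (simp add: integral_density integral_distr)
qed

text \<open>This is the characteristic function of the standard normal distribution at
  \<open>sqrt (2 * pi) * v\<close>. Rescaling the variable by \<open>sqrt (2 * pi)\<close> turns the
  exponent into \<open>- pi * x^2\<close>, and the Jacobian cancels the normalising factor of the
  density.\<close>

lemma
  fixes v :: real
  shows integrable_gauss_real: "integrable lborel (\<lambda>x. complex_of_real (exp (- pi * x\<^sup>2)) * cis (2 * pi * (v * x)))" (is ?I)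
   and integral_gauss_real: "(\<integral>x. complex_of_real (exp (- pi * x\<^sup>2)) * cis (2 * pi * (v * x)) \<partial>lborel) = complex_of_real (exp (- pi * v\<^sup>2))" (is ?E)
proof -
  let ?c = "sqrt (2 * pi)" and ?t = "sqrt (2 * pi) * v"
  let ?g = "\<lambda>x. std_normal_density x *\<^sub>R cis (?t * x)"
  have ig: "integrable lborel ?g"
    by (rule Bochner_Integration.integrable_bound[OF integrable_std_normal_moment[of 0]]) auto
  have c0: "?c \<noteq> 0" by simp
  have eq: "?c *\<^sub>R ?g (0 + ?c * x) = complex_of_real (exp (- pi * x\<^sup>2)) * cis (2 * pi * (v * x))" for x
  proof -
    have "?t * (?c * x) = 2 * pi * (v * x)"
    proof -
      have "?t * (?c * x) = (?c * ?c) * (v * x)" by (simp only: ac_simps)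
      then show ?thesis by simp
    qed
    moreover have "?c * std_normal_density (?c * x) = exp (- pi * x\<^sup>2)"
      by (simp add: std_normal_density_def power_mult_distrib)
    moreover have "?c *\<^sub>R ?g (0 + ?c * x) = complex_of_real (?c * std_normal_density (?c * x)) * cis (?t * (?c * x))"
      by (simp add: scaleR_conv_of_real)
    ultimately show ?thesis by (simp only:)
  qed
  have "complex_of_real (exp (- (?t\<^sup>2) / 2)) = char std_normal_distribution ?t"
    by (simp add: char_std_normal_distribution)
  also have "\<dots> = (\<integral>x. ?g x \<partial>lborel)"
    unfolding char_def by (subst integral_density) (auto simp: cis_conv_exp)
  also have "\<dots> = ?c *\<^sub>R (\<integral>x. ?g (0 + ?c * x) \<partial>lborel)"
    by (subst lborel_integral_real_affine[OF c0, of _ 0]) simp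
  also have "\<dots> = (\<integral>x. ?c *\<^sub>R ?g (0 + ?c * x) \<partial>lborel)" by (rule integral_scaleR_right[symmetric])
  also have "\<dots> = (\<integral>x. complex_of_real (exp (- pi * x\<^sup>2)) * cis (2 * pi * (v * x)) \<partial>lborel)"
    by (simp only: eq)
  also have "- (?t\<^sup>2) / 2 = - pi * v\<^sup>2" by (simp add: power_mult_distrib)
  finally show ?E ..
  have "integrable lborel (\<lambda>x. ?c *\<^sub>R ?g (0 + ?c * x))"
    by (intro integrable_scaleR_right lborel_integrable_real_affine ig c0)
  then show ?I by (simp only: eq)
qed

text \<open>The factor \<open>pi\<close> in the exponent gives total mass 1 in every dimension, so
  this is also an averaging kernel.\<close>

definition gauss :: "'a::euclidean_space \<Rightarrow> real" where
  "gauss z = exp (- pi * (norm z)\<^sup>2)"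

lemma gauss_bounds: "0 < gauss z" "gauss z \<le> 1"
  by (auto simp: gauss_def)

lemma borel_measurable_gauss [measurable]: "gauss \<in> borel_measurable borel"
  unfolding gauss_def by measurable

lemma gauss_mult_cis:
  "complex_of_real (gauss z) * cis (2 * pi * (v \<bullet> z)) =
    (\<Prod>b\<in>Basis. complex_of_real (exp (- pi * (z \<bullet> b)\<^sup>2)) * cis (2 * pi * ((v \<bullet> b) * (z \<bullet> b))))"
proof -
  have "(\<Prod>b\<in>Basis. cis (2 * pi * ((v \<bullet> b) * (z \<bullet> b)))) = cis (\<Sum>b\<in>Basis. 2 * pi * ((v \<bullet> b) * (z \<bullet> b)))"
    by (simp add: cis_conv_exp exp_sum sum_distrib_left)
  also have "(\<Sum>b\<in>Basis. 2 * pi * ((v \<bullet> b) * (z \<bullet> b))) = 2 * pi * (v \<bullet> z)"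
    by (subst (3) euclidean_inner) (simp add: sum_distrib_left)
  finally have 1: "(\<Prod>b\<in>Basis. cis (2 * pi * ((v \<bullet> b) * (z \<bullet> b)))) = cis (2 * pi * (v \<bullet> z))" .
  have "gauss z = exp (\<Sum>b\<in>Basis. - pi * (z \<bullet> b)\<^sup>2)"
    unfolding gauss_def power2_norm_eq_inner by (subst euclidean_inner) (simp add: sum_distrib_left power2_eq_square)
  also have "\<dots> = (\<Prod>b\<in>Basis. exp (- pi * (z \<bullet> b)\<^sup>2))" by (rule exp_sum) simp
  finally show ?thesis by (simp add: prod.distrib 1)
qed

lemma integrable_gauss_cis: "integrable lborel (\<lambda>z. complex_of_real (gauss z) * cis (2 * pi * (v \<bullet> z)))"
  unfolding gauss_mult_cis by (intro integrable_lborel_prod_Basis integrable_gauss_real)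

lemma integral_gauss_cis:
  "(\<integral>z. complex_of_real (gauss z) * cis (2 * pi * (v \<bullet> z)) \<partial>lborel) = complex_of_real (gauss v)"
proof -
  have "(\<integral>z. complex_of_real (gauss z) * cis (2 * pi * (v \<bullet> z)) \<partial>lborel) = 
     (\<Prod>b\<in>Basis. complex_of_real (exp (- pi * (v \<bullet> b)\<^sup>2)))"
    unfolding gauss_mult_cis by (subst integral_lborel_prod_Basis) (use integrable_gauss_real integral_gauss_real in auto)
  also have "\<dots> = complex_of_real (gauss v)" using gauss_mult_cis[of v 0] by simp
  finally show ?thesis .
qed

lemma integrable_gauss: "integrable lborel (gauss :: 'a::euclidean_space \<Rightarrow> real)"
  using integrable_norm[OF integrable_gauss_cis[of "0::'a"]] by (simp add: abs_of_pos[OF gauss_bounds(1)])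

lemma integral_gauss: "(\<integral>z. gauss z \<partial>(lborel :: 'a::euclidean_space measure)) = 1"
proof -
  have "complex_of_real (\<integral>z. gauss z \<partial>(lborel :: 'a measure)) = 1"
    using integral_gauss_cis[of "0::'a"] by (simp add: gauss_def[of 0])
  then show ?thesis using of_real_eq_1_iff by blast
qed

text \<open>The frequency scale \<open>2 * pi\<close> matches \<open>modulation\<close>, so that a
  slice of \<open>STFT\<close> at fixed position is literally a \<open>fourier\<close>
  transform.\<close>

definition fourier :: "('a::euclidean_space \<Rightarrow> complex) \<Rightarrow> 'a \<Rightarrow> complex" where
  "fourier f w = (\<integral>x. f x * cis (- (2 * pi * (w \<bullet> x))) \<partial>lborel)"

text \<open>
  Since \<^const>\<open>gauss\<close> is its own Fourier transform, Fubini's theorem turns the mollification of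
  \<open>f\<close> into an average of \<open>fourier f\<close> against a kernel of modulus at most 1.
\<close>

lemma norm_gauss_mollification_le:
  fixes f :: "'a::euclidean_space \<Rightarrow> complex"
  assumes f: "integrable lborel f" and hf: "integrable lborel (fourier f)" and e: "e > 0"
  shows "cmod (\<integral>z. f (x - e *\<^sub>R z) * gauss z \<partial>lborel) \<le> (\<integral>w. cmod (fourier f w) \<partial>lborel)"
proof -
  note [measurable] = f[THEN borel_measurable_integrable] hf[THEN borel_measurable_integrable]
  have fe: "integrable lborel (\<lambda>z. f (x - e *\<^sub>R z))"
    using integrable_lborel_affine[OF f, of "-e" x] e by simp
  have ip: "integrable (lborel \<Otimes>\<^sub>M lborel) (\<lambda>(z, v). f (x - e *\<^sub>R z) * (complex_of_real (gauss v) * cis (2 * pi * (z \<bullet> v))))"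
  proof (rule Bochner_Integration.integrable_bound)
    show "integrable (lborel \<Otimes>\<^sub>M lborel) (\<lambda>(z, v). cmod (f (x - e *\<^sub>R z)) * gauss (v::'a))"
      using fe by (intro lborel_pair.Fubini_integrable)
        (auto simp: less_imp_le[OF gauss_bounds(1)] abs_of_pos[OF gauss_bounds(1)] integral_gauss integrable_gauss)
  qed (auto simp: norm_mult gauss_bounds less_imp_le intro!: mult_left_mono)
  \<comment> \<open>The substitution \<open>t = x - e *\<^sub>R z\<close> turns the inner integral
    into a phase times \<open>fourier f\<close> at the frequency \<open>v / e\<close>. The factor
    \<open>1 / e ^ DIM('a)\<close> is the Jacobian needed to return from \<open>v / e\<close> to the
    frequency variable, which is why the final bound does not depend on \<open>e\<close>.\<close>
  have inner: "(\<integral>z. f (x - e *\<^sub>R z) * cis (2 * pi * (z \<bullet> v)) \<partial>lborel) = 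
     (1 / e ^ DIM('a)) *\<^sub>R (cis (2 * pi * ((1/e) * (v \<bullet> x))) * fourier f ((1/e) *\<^sub>R v))" for v
  proof -
    let ?h = "\<lambda>t. f t * cis (- (2 * pi * (((1/e) *\<^sub>R v) \<bullet> t)))"
    have ih: "integrable lborel ?h"
      by (rule Bochner_Integration.integrable_bound[OF f]) (auto simp: norm_mult)
    have "fourier f ((1/e) *\<^sub>R v) = \<bar>-e\<bar> ^ DIM('a) *\<^sub>R (\<integral>z. ?h (x + (-e) *\<^sub>R z) \<partial>lborel)"
      unfolding fourier_def by (rule integral_lborel_affine[OF ih]) (use e in auto)
    also have "(\<lambda>z. ?h (x + (-e) *\<^sub>R z)) = (\<lambda>z. cis (- (2 * pi * ((1/e) * (v \<bullet> x)))) * (f (x - e *\<^sub>R z) * cis (2 * pi * (z \<bullet> v))))"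
    proof
      fix z
      have "- (2 * pi * (((1/e) *\<^sub>R v) \<bullet> (x - e *\<^sub>R z))) = - (2 * pi * ((1/e) * (v \<bullet> x))) + 2 * pi * (z \<bullet> v)"
        using e by (simp add: inner_diff_right inner_commute field_simps)
      then have c: "cis (- (2 * pi * (((1/e) *\<^sub>R v) \<bullet> (x - e *\<^sub>R z)))) =
          cis (- (2 * pi * ((1/e) * (v \<bullet> x)))) * cis (2 * pi * (z \<bullet> v))"
        by (simp only: cis_mult)
      have "x + (-e) *\<^sub>R z = x - e *\<^sub>R z" by simp
      then show "?h (x + (-e) *\<^sub>R z) = cis (- (2 * pi * ((1/e) * (v \<bullet> x)))) * (f (x - e *\<^sub>R z) * cis (2 * pi * (z \<bullet> v)))"
        by (simp only: c mult.left_commute)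
    qed
    finally have "fourier f ((1/e) *\<^sub>R v) = e ^ DIM('a) *\<^sub>R (cis (- (2 * pi * ((1/e) * (v \<bullet> x)))) * (\<integral>z. f (x - e *\<^sub>R z) * cis (2 * pi * (z \<bullet> v)) \<partial>lborel))"
      using e by simp
    then have "(1 / e ^ DIM('a)) *\<^sub>R (cis (2 * pi * ((1/e) * (v \<bullet> x))) * fourier f ((1/e) *\<^sub>R v)) =
       (cis (2 * pi * ((1/e) * (v \<bullet> x))) * cis (- (2 * pi * ((1/e) * (v \<bullet> x))))) * (\<integral>z. f (x - e *\<^sub>R z) * cis (2 * pi * (z \<bullet> v)) \<partial>lborel)"
      using e by (simp add: mult.assoc)
    then show ?thesis by (simp add: cis_mult)
  qed
  have "(\<integral>z. f (x - e *\<^sub>R z) * gauss z \<partial>lborel) = 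
     (\<integral>z. (\<integral>v. f (x - e *\<^sub>R z) * (complex_of_real (gauss v) * cis (2 * pi * (z \<bullet> v))) \<partial>lborel) \<partial>lborel)"
    by (simp add: integral_gauss_cis)
  also have "\<dots> = (\<integral>v. (\<integral>z. f (x - e *\<^sub>R z) * (complex_of_real (gauss v) * cis (2 * pi * (z \<bullet> v))) \<partial>lborel) \<partial>lborel)"
    by (rule lborel_pair.Fubini_integral[OF ip, symmetric])
  also have "\<dots> = (\<integral>v. complex_of_real (gauss v) * (\<integral>z. f (x - e *\<^sub>R z) * cis (2 * pi * (z \<bullet> v)) \<partial>lborel) \<partial>lborel)"
    by (simp flip: integral_mult_right_zero add: ac_simps)
  also have "cmod \<dots> \<le> (\<integral>v. (1 / e ^ DIM('a)) *\<^sub>R cmod (fourier f (0 + (1/e) *\<^sub>R v)) \<partial>lborel)"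
  proof (rule Bochner_Integration.integral_norm_bound_integral)
    have i2: "integrable lborel (\<lambda>v. (1 / e ^ DIM('a)) *\<^sub>R cmod (fourier f (0 + (1/e) *\<^sub>R v)))"
      using e by (intro integrable_scaleR_right integrable_norm integrable_lborel_affine hf) auto
    then show "integrable lborel (\<lambda>v. (1 / e ^ DIM('a)) *\<^sub>R cmod (fourier f (0 + (1/e) *\<^sub>R v)))" .
    show b: "cmod (complex_of_real (gauss v) * (\<integral>z. f (x - e *\<^sub>R z) * cis (2 * pi * (z \<bullet> v)) \<partial>lborel))
       \<le> (1 / e ^ DIM('a)) *\<^sub>R cmod (fourier f (0 + (1/e) *\<^sub>R v))" for v
      unfolding inner using e gauss_bounds[of v] by (simp add: norm_mult mult_left_le_one_le divide_right_mono)
    show "integrable lborel (\<lambda>v. complex_of_real (gauss v) * (\<integral>z. f (x - e *\<^sub>R z) * cis (2 * pi * (z \<bullet> v)) \<partial>lborel))"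
      by (rule Bochner_Integration.integrable_bound[OF i2])
        (unfold inner, measurable, use b e in \<open>auto simp: inner\<close>)
  qed
  also have "\<dots> = (\<integral>w. cmod (fourier f w) \<partial>lborel)"
    using e integral_lborel_affine[OF integrable_norm[OF hf], of "1/e" 0] by (simp add: power_one_over)
  finally show ?thesis .
qed

text \<open>Mollifications of \<open>f\<close> at the scales \<open>e n\<close> are bounded by
  \<open>B\<close> everywhere and converge to \<open>f\<close> in L^1. Hence the set where
  \<open>f\<close> exceeds \<open>B\<close> by a fixed amount has measure 0.\<close>

lemma AE_norm_le_integral_fourier:
  fixes f :: "'a::euclidean_space \<Rightarrow> complex"
  assumes f: "integrable lborel f" and hf: "integrable lborel (fourier f)"
  shows "AE x in lborel. cmod (f x) \<le> (\<integral>w. cmod (fourier f w) \<partial>lborel)"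
proof -
  note [measurable] = f[THEN borel_measurable_integrable] hf[THEN borel_measurable_integrable]
  define B where "B = (\<integral>w. cmod (fourier f w) \<partial>lborel)"
  define \<omega> where "\<omega> a = (\<integral>\<^sup>+x. ennreal (norm (f (x - a) - f x)) \<partial>lborel)" for a
  define e where "e n = 1 / real (Suc n)" for n
  have e: "e n > 0" for n by (simp add: e_def)
  have \<omega>_eq: "\<omega> a = ennreal (\<integral>x. norm (f (x - a) - f x) \<partial>lborel)" for a
    unfolding \<omega>_def using f integrable_lborel_shift[OF f, of a] by (intro nn_integral_eq_integral) auto
  have \<omega>m[measurable]: "\<omega> \<in> borel_measurable borel"
    unfolding \<omega>_def by measurable
  have \<omega>_le: "\<omega> a \<le> ennreal (2 * (\<integral>x. norm (f x) \<partial>lborel))" for a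
  proof -
    have "(\<integral>x. norm (f (x - a) - f x) \<partial>lborel) \<le> (\<integral>x. norm (f (x - a)) + norm (f x) \<partial>lborel)"
      using f integrable_lborel_shift[OF f, of a] by (intro integral_mono) (auto simp: norm_triangle_ineq4)
    also have "\<dots> = (\<integral>x. norm (f (x - a)) \<partial>lborel) + (\<integral>x. norm (f x) \<partial>lborel)"
      using f integrable_lborel_shift[OF f, of a] by (intro Bochner_Integration.integral_add) auto
    also have "(\<integral>x. norm (f (x - a)) \<partial>lborel) = (\<integral>x. norm (f x) \<partial>lborel)"
      by (rule integral_lborel_shift) measurable
    finally show ?thesis unfolding \<omega>_eq by (intro ennreal_leI) simp
  qed
  have \<omega>_lim: "(\<lambda>n. \<omega> (e n *\<^sub>R z)) \<longlonglongrightarrow> 0" for z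
  proof -
    have "(\<lambda>n. \<integral>x. norm (f (x - e n *\<^sub>R z) - f x) \<partial>lborel) \<longlonglongrightarrow> 0"
    proof (rule LIMSEQ_I)
      fix r :: real assume r: "r > 0"
      obtain d where d: "d > 0" "\<And>a. norm a < d \<Longrightarrow> (\<integral>x. norm (f (x - a) - f x) \<partial>lborel) \<le> r/2"
        using translation_continuous_L1[OF f, of "r/2"] r by auto
      have "(\<lambda>n. norm (e n *\<^sub>R z)) \<longlonglongrightarrow> norm (0 *\<^sub>R z)"
        unfolding e_def by (intro tendsto_intros LIMSEQ_Suc lim_1_over_n)
      then have "\<forall>\<^sub>F n in sequentially. norm (e n *\<^sub>R z) < d"
        by (rule order_tendstoD) (use d in auto)
      then obtain N where N: "\<And>n. n \<ge> N \<Longrightarrow> norm (e n *\<^sub>R z) < d" by (auto simp: eventually_sequentially)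
      have "norm ((\<integral>x. norm (f (x - e n *\<^sub>R z) - f x) \<partial>lborel) - 0) < r" if "n \<ge> N" for n
        using d(2)[OF N[OF that]] r by simp
      then show "\<exists>N. \<forall>n\<ge>N. norm ((\<integral>x. norm (f (x - e n *\<^sub>R z) - f x) \<partial>lborel) - 0) < r"
        by blast
    qed
    then show ?thesis unfolding \<omega>_eq by (simp add: tendsto_ennreal_iff[of _ _ 0, simplified])
  qed
  define D where "D n x = (\<integral>z. f (x - e n *\<^sub>R z) * gauss z \<partial>lborel) - f x" for n x
  \<comment> \<open>Minkowski's inequality for integrals, by Tonelli: the L^1 error of the
    mollification is at most the Gaussian average of the L^1 modulus of continuity
    \<open>\<omega>\<close>, which is dominated by a multiple of \<open>gauss\<close>.\<close>
  have D_le: "(\<integral>\<^sup>+x. ennreal (cmod (D n x)) \<partial>lborel) \<le> (\<integral>\<^sup>+z. \<omega> (e n *\<^sub>R z) * ennreal (gauss z) \<partial>lborel)" for n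
  proof -
    have "ennreal (cmod (D n x)) \<le> (\<integral>\<^sup>+z. ennreal (cmod (f (x - e n *\<^sub>R z) - f x) * gauss z) \<partial>lborel)" for x
    proof -
      have fe: "integrable lborel (\<lambda>z. f (x - e n *\<^sub>R z))"
        using integrable_lborel_affine[OF f, of "- e n" x] e[of n] by simp
      have i1: "integrable lborel (\<lambda>z. f (x - e n *\<^sub>R z) * gauss z)"
        by (rule Bochner_Integration.integrable_bound[OF fe])
          (auto simp: norm_mult less_imp_le gauss_bounds intro!: mult_right_le_one_le)
      have i2: "integrable lborel (\<lambda>z. f x * gauss (z::'a))"
        by (intro integrable_mult_right integrable_of_real integrable_gauss)
      have "D n x = (\<integral>z. f (x - e n *\<^sub>R z) * gauss z \<partial>lborel) - (\<integral>z. f x * gauss (z::'a) \<partial>lborel)"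
        unfolding D_def by (simp add: integral_gauss)
      also have "\<dots> = (\<integral>z. (f (x - e n *\<^sub>R z) - f x) * gauss z \<partial>lborel)"
        by (subst Bochner_Integration.integral_diff[OF i1 i2, symmetric]) (simp add: left_diff_distrib)
      finally have D: "D n x = (\<integral>z. (f (x - e n *\<^sub>R z) - f x) * gauss z \<partial>lborel)" .
      have i3: "integrable lborel (\<lambda>z. (f (x - e n *\<^sub>R z) - f x) * gauss z)"
        using Bochner_Integration.integrable_diff[OF i1 i2] by (simp add: left_diff_distrib)
      have "ennreal (cmod (D n x)) \<le> (\<integral>\<^sup>+z. ennreal (norm ((f (x - e n *\<^sub>R z) - f x) * gauss z)) \<partial>lborel)"
        unfolding D by (rule integral_norm_bound_ennreal[OF i3])
      then show ?thesis by (simp add: norm_mult gauss_bounds less_imp_le)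
    qed
    then have "(\<integral>\<^sup>+x. ennreal (cmod (D n x)) \<partial>lborel) \<le>
       (\<integral>\<^sup>+x. (\<integral>\<^sup>+z. ennreal (cmod (f (x - e n *\<^sub>R z) - f x) * gauss z) \<partial>lborel) \<partial>lborel)"
      by (intro nn_integral_mono)
    also have "\<dots> = (\<integral>\<^sup>+z. (\<integral>\<^sup>+x. ennreal (cmod (f (x - e n *\<^sub>R z) - f x) * gauss z) \<partial>lborel) \<partial>lborel)"
      by (rule lborel_pair.Fubini') measurable
    also have "\<dots> = (\<integral>\<^sup>+z. \<omega> (e n *\<^sub>R z) * ennreal (gauss z) \<partial>lborel)"
      unfolding \<omega>_def by (simp add: ennreal_mult gauss_bounds less_imp_le nn_integral_multc)
    finally show ?thesis .
  qed
  have "(\<lambda>n. \<integral>\<^sup>+z. \<omega> (e n *\<^sub>R z) * ennreal (gauss z) \<partial>lborel) \<longlonglongrightarrow> (\<integral>\<^sup>+z. 0 \<partial>(lborel :: 'a measure))"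
  proof (rule nn_integral_dominated_convergence)
    show "AE z in lborel. \<omega> (e n *\<^sub>R z) * ennreal (gauss z) \<le> ennreal (2 * (\<integral>x. norm (f x) \<partial>lborel) * gauss z)" for n
      using \<omega>_le by (auto simp: ennreal_mult gauss_bounds less_imp_le intro!: mult_right_mono)
    show "(\<integral>\<^sup>+z. ennreal (2 * (\<integral>x. norm (f x) \<partial>lborel) * gauss (z::'a)) \<partial>lborel) < \<infinity>"
      using nn_integral_eq_integral[of lborel "\<lambda>z::'a. 2 * (\<integral>x. norm (f x) \<partial>lborel) * gauss z"] integrable_gauss[where 'a='a]
      by (simp add: gauss_bounds less_imp_le)
    show "AE z in lborel. (\<lambda>n. \<omega> (e n *\<^sub>R z) * ennreal (gauss z)) \<longlonglongrightarrow> 0"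
      using tendsto_mult_ennreal[OF \<omega>_lim tendsto_const] by (intro AE_I2) fastforce
  qed measurable
  then have lim: "(\<lambda>n. \<integral>\<^sup>+z. \<omega> (e n *\<^sub>R z) * ennreal (gauss z) \<partial>lborel) \<longlonglongrightarrow> 0" by simp
  have null: "AE x in lborel. cmod (f x) \<le> B + e m" for m
  proof -
    let ?A = "{x. cmod (f x) > B + e m}"
    \<comment> \<open>Markov's inequality: on \<open>?A\<close> the mollification stays below
      \<open>B\<close> in modulus, so it misses \<open>f\<close> by at least \<open>e m\<close>. The
      level index \<open>m\<close> is fixed while the scale index \<open>n\<close> tends to
      infinity.\<close>
    have "ennreal (e m) * emeasure lborel ?A \<le> (\<integral>\<^sup>+z. \<omega> (e n *\<^sub>R z) * ennreal (gauss z) \<partial>lborel)" for n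
    proof -
      have "ennreal (e m) * emeasure lborel ?A = (\<integral>\<^sup>+x. ennreal (e m) * indicator ?A x \<partial>lborel)"
        by (subst nn_integral_cmult_indicator) auto
      also have "\<dots> \<le> (\<integral>\<^sup>+x. ennreal (cmod (D n x)) \<partial>lborel)"
      proof (intro nn_integral_mono)
        fix x
        have "cmod (D n x) \<ge> cmod (f x) - B"
          using norm_gauss_mollification_le[OF f hf e[of n], of x]
            norm_triangle_ineq2[of "f x" "(\<integral>z. f (x - e n *\<^sub>R z) * gauss z \<partial>lborel)"]
          unfolding D_def B_def by (simp add: norm_minus_commute)
        then show "ennreal (e m) * indicator ?A x \<le> ennreal (cmod (D n x))"
          using e[of m] by (auto simp: indicator_def intro!: ennreal_leI)
      qed
      finally show ?thesis using D_le[of n] by simp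
    qed
    then have "ennreal (e m) * emeasure lborel ?A \<le> 0"
      using lim by (intro LIMSEQ_le_const[OF lim]) auto
    then have "emeasure lborel ?A = 0" using e[of m] by simp
    then have "AE x in lborel. x \<notin> ?A" by (intro AE_not_in) (auto simp: null_sets_def)
    then show ?thesis by (simp add: not_less)
  qed
  have "AE x in lborel. \<forall>m. cmod (f x) \<le> B + e m" using null by (simp add: AE_all_countable)
  then show ?thesis
  proof (rule AE_mp, intro AE_I2 impI)
    fix x assume "\<forall>m. cmod (f x) \<le> B + e m"
    moreover have "(\<lambda>m. B + e m) \<longlonglongrightarrow> B + 0"
      unfolding e_def by (intro tendsto_intros LIMSEQ_Suc lim_1_over_n)
    ultimately show "cmod (f x) \<le> (\<integral>w. cmod (fourier f w) \<partial>lborel)"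
      using LIMSEQ_le_const[of "\<lambda>m. B + e m" B "cmod (f x)"] unfolding B_def by simp
  qed
qed

section \<open>The space \<open>L2\<close>\<close>

lemma borel_measurable_cnj [measurable]: "cnj \<in> borel_measurable borel"
  by (intro borel_measurable_continuous_onI continuous_intros)

lemma L2_borel [measurable_dest]: "f \<in> L2 \<Longrightarrow> f \<in> borel_measurable borel"
  by (simp add: L2_def)

lemma L2_integrable_power2: "f \<in> L2 \<Longrightarrow> integrable lborel (\<lambda>x. (cmod (f x))\<^sup>2)"
  by (simp add: L2_def)

lemma L2_bounded_by:
  assumes g: "g \<in> L2" and [measurable]: "f \<in> borel_measurable borel"
    and le: "\<And>x. cmod (f x) \<le> c * cmod (g x)"
  shows "f \<in> L2"
proof -
  have "integrable lborel (\<lambda>x. c\<^sup>2 * (cmod (g x))\<^sup>2)" using L2_integrable_power2[OF g] by simp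
  then have "integrable lborel (\<lambda>x. (cmod (f x))\<^sup>2)"
    by (rule Bochner_Integration.integrable_bound)
      (use le power_mono[OF le, of _ 2] in \<open>auto simp: power_mult_distrib\<close>)
  then show ?thesis by (simp add: L2_def)
qed

lemma L2_scale: "f \<in> L2 \<Longrightarrow> (\<lambda>x. c * f x) \<in> L2"
  by (rule L2_bounded_by[of f _ "cmod c"]) (auto simp: norm_mult)

lemma L2_add:
  assumes f: "f \<in> L2" and g: "g \<in> L2" shows "(\<lambda>x. f x + g x) \<in> L2"
proof -
  note [measurable] = L2_borel[OF f] L2_borel[OF g]
  have "integrable lborel (\<lambda>x. 2 * (cmod (f x))\<^sup>2 + 2 * (cmod (g x))\<^sup>2)"
    using f g by (simp add: L2_def)
  then have "integrable lborel (\<lambda>x. (cmod (f x + g x))\<^sup>2)"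
  proof (rule Bochner_Integration.integrable_bound)
    have "(cmod (f x + g x))\<^sup>2 \<le> 2 * (cmod (f x))\<^sup>2 + 2 * (cmod (g x))\<^sup>2" for x
      using power_mono[OF norm_triangle_ineq[of "f x" "g x"], of 2]
         zero_le_power2[of "cmod (f x) - cmod (g x)"]
      by (simp add: power2_sum power2_diff)
    then show "AE x in lborel. norm ((cmod (f x + g x))\<^sup>2) \<le> norm (2 * (cmod (f x))\<^sup>2 + 2 * (cmod (g x))\<^sup>2)"
      by auto
  qed measurable
  then show ?thesis by (simp add: L2_def)
qed

lemma L2_zero: "(\<lambda>x. 0) \<in> L2"
  by (simp add: L2_def)

lemma L2_diff: "f \<in> L2 \<Longrightarrow> g \<in> L2 \<Longrightarrow> (\<lambda>x. f x - g x) \<in> L2"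
  using L2_add[of f "\<lambda>x. - 1 * g x"] L2_scale[of g "-1"] by simp

lemma L2_sum: "(\<And>i. i \<in> F \<Longrightarrow> f i \<in> L2) \<Longrightarrow> (\<lambda>x. \<Sum>i\<in>F. f i x) \<in> L2"
  by (induction F rule: infinite_finite_induct) (auto intro: L2_zero L2_add)

lemma L2_translation:
  assumes f: "f \<in> L2" shows "translation a f \<in> L2"
proof -
  note [measurable] = L2_borel[OF f]
  show ?thesis
    using integrable_lborel_shift[OF L2_integrable_power2[OF f], of a] by (simp add: L2_def translation_def)
qed

lemma modulation_cis: "modulation b f x = cis (2 * pi * (b \<bullet> x)) * f x"
  by (simp add: modulation_def cis_conv_exp ac_simps)

lemma cmod_modulation [simp]: "cmod (modulation b f x) = cmod (f x)"
  by (simp add: modulation_cis norm_mult)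

lemma L2_modulation:
  assumes f: "f \<in> L2" shows "modulation b f \<in> L2"
proof -
  note [measurable] = L2_borel[OF f]
  have "modulation b f = (\<lambda>x. cis (2 * pi * (b \<bullet> x)) * f x)" by (simp add: modulation_cis fun_eq_iff)
  then show ?thesis
    by (intro L2_bounded_by[OF f, of _ 1]) (auto simp: norm_mult)
qed

lemma L2_norm_nonneg: "0 \<le> L2_norm f"
  by (simp add: L2_norm_def)

lemma L2_norm_power2: "(L2_norm f)\<^sup>2 = (\<integral>x. (cmod (f x))\<^sup>2 \<partial>lborel)"
  by (simp add: L2_norm_def)

lemma L2_norm_translation:
  assumes f: "f \<in> L2" shows "L2_norm (translation a f) = L2_norm f"
proof -
  note [measurable] = L2_borel[OF f]
  show ?thesis unfolding L2_norm_def translation_def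
    by (subst integral_lborel_shift[where f="\<lambda>x. (cmod (f x))\<^sup>2"]) auto
qed

lemma L2_norm_modulation [simp]: "L2_norm (modulation b f) = L2_norm f"
  by (simp add: L2_norm_def)

lemma L2_norm_scale: "L2_norm (\<lambda>x. c * f x) = cmod c * L2_norm f"
  by (simp add: L2_norm_def norm_mult power_mult_distrib real_sqrt_mult)

lemma L2_norm_power2_ennreal:
  "f \<in> L2 \<Longrightarrow> ennreal ((L2_norm f)\<^sup>2) = (\<integral>\<^sup>+x. (ennreal (cmod (f x)))\<^sup>2 \<partial>lborel)"
  unfolding L2_norm_power2 using L2_integrable_power2[of f]
  by (subst nn_integral_eq_integral[symmetric]) (auto simp: ennreal_power)

lemma L2_norm_mono:
  assumes f: "f \<in> L2" and g: "g \<in> L2" and le: "\<And>x. cmod (f x) \<le> c * cmod (g x)" and c: "c \<ge> 0"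
  shows "L2_norm f \<le> c * L2_norm g"
proof -
  have "(L2_norm f)\<^sup>2 \<le> (\<integral>x. c\<^sup>2 * (cmod (g x))\<^sup>2 \<partial>lborel)"
    unfolding L2_norm_power2 using f g power_mono[OF le, of _ 2]
    by (intro integral_mono) (auto simp: L2_def power_mult_distrib)
  also have "\<dots> = (c * L2_norm g)\<^sup>2" by (simp add: power_mult_distrib L2_norm_power2)
  finally show ?thesis using c L2_norm_nonneg[of g] by (simp add: power2_le_iff_abs_le)
qed

lemma integrable_L2_mult:
  assumes f: "f \<in> L2" and g: "g \<in> L2"
  shows "integrable lborel (\<lambda>x. f x * cnj (g x))"
proof -
  note [measurable] = L2_borel[OF f] L2_borel[OF g]
  have "integrable lborel (\<lambda>x. (cmod (f x))\<^sup>2 + (cmod (g x))\<^sup>2)"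
    using f g by (simp add: L2_def)
  then show ?thesis
  proof (rule Bochner_Integration.integrable_bound)
    have "cmod (f x) * cmod (g x) \<le> (cmod (f x))\<^sup>2 + (cmod (g x))\<^sup>2" for x
      using sum_squares_bound[of "cmod (f x)" "cmod (g x)"] mult_nonneg_nonneg[of "cmod (f x)" "cmod (g x)"]
      unfolding mult.assoc by (smt (verit) norm_ge_zero)
    then show "AE x in lborel. norm (f x * cnj (g x)) \<le> norm ((cmod (f x))\<^sup>2 + (cmod (g x))\<^sup>2)"
      by (auto simp: norm_mult)
  qed measurable
qed

lemma L2_inner_add_left:
  "f \<in> L2 \<Longrightarrow> g \<in> L2 \<Longrightarrow> h \<in> L2 \<Longrightarrow> L2_inner (\<lambda>x. f x + g x) h = L2_inner f h + L2_inner g h"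
  unfolding L2_inner_def by (simp add: distrib_right integrable_L2_mult)

lemma L2_inner_diff_left:
  "f \<in> L2 \<Longrightarrow> g \<in> L2 \<Longrightarrow> h \<in> L2 \<Longrightarrow> L2_inner (\<lambda>x. f x - g x) h = L2_inner f h - L2_inner g h"
  unfolding L2_inner_def by (simp add: left_diff_distrib integrable_L2_mult)

lemma L2_inner_scale_left: "L2_inner (\<lambda>x. c * f x) h = c * L2_inner f h"
  unfolding L2_inner_def by (simp add: mult.assoc)

lemma L2_inner_sum_left:
  "(\<And>i. i \<in> F \<Longrightarrow> f i \<in> L2) \<Longrightarrow> h \<in> L2 \<Longrightarrow> L2_inner (\<lambda>x. \<Sum>i\<in>F. f i x) h = (\<Sum>i\<in>F. L2_inner (f i) h)"
  unfolding L2_inner_def by (simp add: sum_distrib_right integrable_L2_mult)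

lemma L2_inner_self: "L2_inner f f = complex_of_real ((L2_norm f)\<^sup>2)"
  unfolding L2_inner_def L2_norm_power2 by (simp flip: complex_norm_square integral_complex_of_real)

section \<open>Cauchy-Schwarz, triangle inequality and parallelogram law\<close>

lemma L2_Cauchy_Schwarz_ennreal:
  assumes f: "f \<in> L2" and g: "g \<in> L2"
  shows "(\<integral>\<^sup>+x. ennreal (cmod (f x)) * ennreal (cmod (g x)) \<partial>lborel) \<le> ennreal (L2_norm f * L2_norm g)"
proof -
  note [measurable] = L2_borel[OF f] L2_borel[OF g]
  have "(\<integral>\<^sup>+x. ennreal (cmod (f x)) * ennreal (cmod (g x)) \<partial>lborel)\<^sup>2 \<le>
     (\<integral>\<^sup>+x. (ennreal (cmod (f x)))\<^sup>2 \<partial>lborel) * (\<integral>\<^sup>+x. (ennreal (cmod (g x)))\<^sup>2 \<partial>lborel)"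
    by (rule Cauchy_Schwarz_nn_integral) measurable
  also have "\<dots> = ennreal ((L2_norm f)\<^sup>2) * ennreal ((L2_norm g)\<^sup>2)"
    using f g by (simp add: L2_norm_power2_ennreal)
  also have "\<dots> = (ennreal (L2_norm f * L2_norm g))\<^sup>2"
    by (simp add: ennreal_power L2_norm_nonneg power_mult_distrib flip: ennreal_mult)
  finally have *: "(\<integral>\<^sup>+x. ennreal (cmod (f x)) * ennreal (cmod (g x)) \<partial>lborel)\<^sup>2 \<le> (ennreal (L2_norm f * L2_norm g))\<^sup>2" .
  show ?thesis
  proof (cases "\<integral>\<^sup>+x. ennreal (cmod (f x)) * ennreal (cmod (g x)) \<partial>lborel")
    case (real r)
    then have "ennreal (r\<^sup>2) \<le> ennreal ((L2_norm f * L2_norm g)\<^sup>2)"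
      using * by (simp add: ennreal_power L2_norm_nonneg)
    then have "r\<^sup>2 \<le> (L2_norm f * L2_norm g)\<^sup>2" by simp
    then have "r \<le> L2_norm f * L2_norm g"
      by (rule power2_le_imp_le) (simp add: L2_norm_nonneg)
    then show ?thesis unfolding real by (rule ennreal_leI)
  next
    case top then show ?thesis using * by (simp add: ennreal_power L2_norm_nonneg top_unique)
  qed
qed

lemma L2_Cauchy_Schwarz:
  assumes f: "f \<in> L2" and g: "g \<in> L2"
  shows "cmod (L2_inner f g) \<le> L2_norm f * L2_norm g"
proof -
  have "ennreal (cmod (L2_inner f g)) \<le> (\<integral>\<^sup>+x. ennreal (norm (f x * cnj (g x))) \<partial>lborel)"
    unfolding L2_inner_def by (rule integral_norm_bound_ennreal[OF integrable_L2_mult[OF f g]])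
  also have "\<dots> \<le> ennreal (L2_norm f * L2_norm g)"
    using L2_Cauchy_Schwarz_ennreal[OF f g] by (simp add: norm_mult ennreal_mult)
  finally show ?thesis by (simp add: L2_norm_nonneg)
qed

lemma L2_norm_add_power2:
  assumes f: "f \<in> L2" and g: "g \<in> L2"
  shows "(L2_norm (\<lambda>x. f x + g x))\<^sup>2 = (L2_norm f)\<^sup>2 + 2 * Re (L2_inner f g) + (L2_norm g)\<^sup>2"
proof -
  have i: "integrable lborel (\<lambda>x. Re (f x * cnj (g x)))" 
    using integrable_L2_mult[OF f g] by (rule integrable_Re)
  have "(L2_norm (\<lambda>x. f x + g x))\<^sup>2 = (\<integral>x. (cmod (f x))\<^sup>2 + 2 * Re (f x * cnj (g x)) + (cmod (g x))\<^sup>2 \<partial>lborel)"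
    unfolding L2_norm_power2
    by (intro Bochner_Integration.integral_cong refl) (simp add: cmod_power2 power2_sum algebra_simps)
  also have "\<dots> = (L2_norm f)\<^sup>2 + 2 * (\<integral>x. Re (f x * cnj (g x)) \<partial>lborel) + (L2_norm g)\<^sup>2"
    unfolding L2_norm_power2 using i f g
    by (subst Bochner_Integration.integral_add, auto simp del: times_complex.sel simp add: L2_def)+
  also have "(\<integral>x. Re (f x * cnj (g x)) \<partial>lborel) = Re (L2_inner f g)"
    unfolding L2_inner_def by (rule integral_Re[OF integrable_L2_mult[OF f g]])
  finally show ?thesis .
qed

lemma L2_norm_triangle:
  assumes f: "f \<in> L2" and g: "g \<in> L2"
  shows "L2_norm (\<lambda>x. f x + g x) \<le> L2_norm f + L2_norm g"
proof -
  have "Re (L2_inner f g) \<le> L2_norm f * L2_norm g"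
    using complex_Re_le_cmod[of "L2_inner f g"] L2_Cauchy_Schwarz[OF f g] by simp
  then have "(L2_norm (\<lambda>x. f x + g x))\<^sup>2 \<le> (L2_norm f + L2_norm g)\<^sup>2"
    unfolding L2_norm_add_power2[OF f g] by (simp add: power2_sum)
  then show ?thesis using L2_norm_nonneg[of f] L2_norm_nonneg[of g] by (simp add: power2_le_iff_abs_le)
qed

lemma L2_norm_triangle_diff:
  assumes f: "f \<in> L2" and g: "g \<in> L2"
  shows "L2_norm (\<lambda>x. f x - g x) \<le> L2_norm f + L2_norm g"
  using L2_norm_triangle[OF f L2_scale[OF g, of "-1"]] L2_norm_scale[of "-1" g] by simp

lemma L2_norm_sum_le:
  assumes "finite F" "\<And>i. i \<in> F \<Longrightarrow> f i \<in> L2"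
  shows "L2_norm (\<lambda>x. \<Sum>i\<in>F. f i x) \<le> (\<Sum>i\<in>F. L2_norm (f i))"
  using assms
proof (induction F rule: finite_induct)
  case empty then show ?case by (simp add: L2_norm_def)
next
  case (insert i F)
  have "L2_norm (\<lambda>x. f i x + (\<Sum>i\<in>F. f i x)) \<le> L2_norm (f i) + L2_norm (\<lambda>x. \<Sum>i\<in>F. f i x)"
    using insert by (intro L2_norm_triangle L2_sum) auto
  then show ?case using insert by simp
qed

lemma L2_parallelogram:
  assumes f: "f \<in> L2" and g: "g \<in> L2"
  shows "(L2_norm (\<lambda>x. f x + g x))\<^sup>2 + (L2_norm (\<lambda>x. f x - g x))\<^sup>2 = 2 * (L2_norm f)\<^sup>2 + 2 * (L2_norm g)\<^sup>2"
proof -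
  have "(L2_norm (\<lambda>x. f x - g x))\<^sup>2 = (L2_norm f)\<^sup>2 + 2 * Re (L2_inner f (\<lambda>x. - 1 * g x)) + (L2_norm g)\<^sup>2"
    using L2_norm_add_power2[OF f L2_scale[OF g, of "-1"]] L2_norm_scale[of "-1" g] by simp
  moreover have "L2_inner f (\<lambda>x. - 1 * g x) = - L2_inner f g"
    by (simp add: L2_inner_def)
  ultimately show ?thesis using L2_norm_add_power2[OF f g] by simp
qed

lemma L2_norm_eq_0_iff: 
  assumes f: "f \<in> L2" shows "L2_norm f = 0 \<longleftrightarrow> (AE x in lborel. f x = 0)"
proof -
  have "L2_norm f = 0 \<longleftrightarrow> (\<integral>x. (cmod (f x))\<^sup>2 \<partial>lborel) = 0"
    by (simp add: L2_norm_def)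
  also have "\<dots> \<longleftrightarrow> (AE x in lborel. (cmod (f x))\<^sup>2 = 0)"
    using L2_integrable_power2[OF f] by (intro integral_nonneg_eq_0_iff_AE) auto
  finally show ?thesis by simp
qed

text \<open>
  Applied to \<open>z = f (x - a)\<close> and \<open>w = f x\<close>, this reduces continuity of translations in \<open>L2\<close> to
  their continuity in \<open>L\<^sup>1\<close>, for the integrable function \<open>\<bar>f\<bar> f\<close>.
\<close>

lemma power2_dist_le_dist_mult_norm:
  fixes z w :: "'a::real_inner"
  shows "(norm (z - w))\<^sup>2 \<le> 2 * norm (norm z *\<^sub>R z - norm w *\<^sub>R w)"
proof (cases "z = w")
  case False
  define s t p where "s = norm z" and "t = norm w" and "p = z \<bullet> w"
  have st: "s \<ge> 0" "t \<ge> 0" by (auto simp: s_def t_def)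
  have n: "(norm (z - w))\<^sup>2 = s\<^sup>2 + t\<^sup>2 - 2 * p"
    by (simp add: power2_norm_eq_inner inner_diff_left inner_diff_right inner_commute s_def t_def p_def)
  \<comment> \<open>Monotonicity of the map sending z to its norm times z: twice this pairing equals
    \<open>(s + t) * (norm (z - w))\<^sup>2\<close> plus the nonnegative term
    \<open>(s + t) * (s - t)\<^sup>2\<close>. Cauchy-Schwarz bounds it from above, and
    \<open>s + t \<ge> norm (z - w)\<close> allows one factor to be cancelled.\<close>
  have "(s *\<^sub>R z - t *\<^sub>R w) \<bullet> (z - w) = s ^ 3 + t ^ 3 - (s + t) * p"
    by (simp add: inner_diff_left inner_diff_right inner_commute p_def algebra_simps s_def t_def
         power3_eq_cube flip: power2_norm_eq_inner) (simp add: power2_eq_square)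
  moreover have eq: "2 * (s ^ 3 + t ^ 3 - (s + t) * p) = (s + t) * (s\<^sup>2 + t\<^sup>2 - 2 * p) + (s + t) * (s - t)\<^sup>2"
    by (simp add: power2_eq_square power3_eq_cube algebra_simps)
  moreover have "(s + t) * (s - t)\<^sup>2 \<ge> 0" using st by simp
  ultimately have "(s + t) * (norm (z - w))\<^sup>2 \<le> 2 * ((s *\<^sub>R z - t *\<^sub>R w) \<bullet> (z - w))"
    unfolding n by (simp only: eq le_add_same_cancel1)
  also have "\<dots> \<le> 2 * (norm (s *\<^sub>R z - t *\<^sub>R w) * norm (z - w))"
    using norm_cauchy_schwarz by auto
  finally have 1: "(s + t) * (norm (z - w))\<^sup>2 \<le> 2 * (norm (s *\<^sub>R z - t *\<^sub>R w) * norm (z - w))" .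
  have "norm (z - w) * (norm (z - w))\<^sup>2 \<le> (s + t) * (norm (z - w))\<^sup>2"
    using norm_triangle_ineq4[of z w] by (intro mult_right_mono) (auto simp: s_def t_def)
  also note 1
  finally have "norm (z - w) * (norm (z - w))\<^sup>2 \<le> norm (z - w) * (2 * norm (s *\<^sub>R z - t *\<^sub>R w))"
    by (simp add: ac_simps)
  then show ?thesis using False by (simp add: s_def t_def)
qed auto

lemma translation_continuous_L2:
  assumes f: "f \<in> L2" and e: "e > 0"
  shows "\<exists>d>0. \<forall>a. norm a < d \<longrightarrow> L2_norm (\<lambda>x. translation a f x - f x) \<le> e"
proof -
  note [measurable] = L2_borel[OF f]
  let ?F = "\<lambda>x. norm (f x) *\<^sub>R f x"
  have F: "integrable lborel ?F"
    by (rule Bochner_Integration.integrable_bound[OF L2_integrable_power2[OF f]]) (auto simp: power2_eq_square)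
  obtain d where d: "d > 0" "\<And>a. norm a < d \<Longrightarrow> (\<integral>x. norm (?F (x - a) - ?F x) \<partial>lborel) \<le> e\<^sup>2 / 2"
    using translation_continuous_L1[OF F, of "e\<^sup>2 / 2"] e by auto
  show ?thesis
  proof (intro exI[of _ d] conjI allI impI)
    fix a :: 'a assume a: "norm a < d"
    have iF: "integrable lborel (\<lambda>x. 2 * norm (?F (x - a) - ?F x))"
      using F integrable_lborel_shift[OF F, of a] by auto
    have "(L2_norm (\<lambda>x. translation a f x - f x))\<^sup>2 \<le> (\<integral>x. 2 * norm (?F (x - a) - ?F x) \<partial>lborel)"
      unfolding L2_norm_power2
      by (rule integral_mono) (use iF L2_integrable_power2[OF L2_diff[OF L2_translation[OF f, of a] f]] 
         power2_dist_le_dist_mult_norm in \<open>auto simp: translation_def\<close>)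
    also have "\<dots> \<le> e\<^sup>2" using d(2)[OF a] by simp
    finally show "L2_norm (\<lambda>x. translation a f x - f x) \<le> e" using e by (simp add: power2_le_iff_abs_le)
  qed (use d in auto)
qed

lemma L2_norm_translation_diff:
  "L2_norm (\<lambda>x. translation a f x - translation b f x) = L2_norm (\<lambda>x. translation (a - b) f x - f x)" if f: "f \<in> L2"
proof -
  have "(\<lambda>x. translation a f x - translation b f x) = translation b (\<lambda>x. translation (a - b) f x - f x)"
    by (auto simp: translation_def algebra_simps)
  then show ?thesis using f by (simp add: L2_norm_translation L2_diff L2_translation)
qed

text \<open>Uniformity over \<open>A\<close> comes from a finite net. Moving a translation to the
  nearest net point changes the pairing by at most \<open>e/2\<close>, whatever \<open>b\<close> is,
  because modulation preserves the norm of \<open>g\<close>; the finitely many net points share one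
  threshold for \<open>b\<close>.\<close>

lemma Riemann_Lebesgue_translates:
  fixes h g :: "'a::euclidean_space \<Rightarrow> complex"
  assumes h: "h \<in> L2" and g: "g \<in> L2" and A: "bounded A" and e: "e > 0"
  shows "\<exists>R. \<forall>b. norm b > R \<longrightarrow> (\<forall>a\<in>A. cmod (L2_inner (translation a h) (modulation b g)) \<le> e)"
proof -
  have "e / (2 * (L2_norm g + 1)) > 0" using e L2_norm_nonneg[of g] by (simp add: add_nonneg_pos)
  from translation_continuous_L2[OF h this] obtain d where
    d: "d > 0" "\<And>a. norm a < d \<Longrightarrow> L2_norm (\<lambda>x. translation a h x - h x) \<le> e / (2 * (L2_norm g + 1))" by auto
  obtain P where P: "finite P" "closure A \<subseteq> (\<Union>a\<in>P. ball a d)"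
    using A d compact_eq_totally_bounded[of "closure A"] by (auto simp: compact_closure)
  have "\<exists>R. \<forall>b. norm b > R \<longrightarrow> cmod (L2_inner (translation a h) (modulation b g)) \<le> e/2" for a :: 'a
  proof -
    have "L2_inner (translation a h) (modulation b g) = (\<integral>x. (translation a h x * cnj (g x)) * cis (- (2 * pi * (b \<bullet> x))) \<partial>lborel)" for b
      unfolding L2_inner_def by (intro Bochner_Integration.integral_cong refl) (simp add: modulation_cis cis_cnj)
    then show ?thesis
      using Riemann_Lebesgue[OF integrable_L2_mult[OF L2_translation[OF h, of a] g], of "e/2"] e by simp
  qed
  then obtain R :: "'a \<Rightarrow> real" where R: "\<And>a b. norm b > R a \<Longrightarrow> cmod (L2_inner (translation a h) (modulation b g)) \<le> e/2"
    by metis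
  show ?thesis
  proof (intro exI[of _ "\<Sum>a\<in>P. \<bar>R a\<bar>"] allI impI ballI)
    fix b a :: 'a assume b: "norm b > (\<Sum>a\<in>P. \<bar>R a\<bar>)" and "a \<in> A"
    then have "a \<in> (\<Union>a\<in>P. ball a d)" using P(2) closure_subset[of A] by blast
    then obtain a' where a': "a' \<in> P" "dist a' a < d" by auto
    have "\<bar>R a'\<bar> \<le> (\<Sum>a\<in>P. \<bar>R a\<bar>)" using a' P by (intro member_le_sum) auto
    then have 1: "cmod (L2_inner (translation a' h) (modulation b g)) \<le> e/2" using b by (intro R) auto
    have "cmod (L2_inner (\<lambda>x. translation a h x - translation a' h x) (modulation b g)) \<le> 
       L2_norm (\<lambda>x. translation a h x - translation a' h x) * L2_norm (modulation b g)"
      using h g by (intro L2_Cauchy_Schwarz L2_diff L2_translation L2_modulation)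
    also have "\<dots> \<le> (e / (2 * (L2_norm g + 1))) * L2_norm g"
      unfolding L2_norm_translation_diff[OF h] L2_norm_modulation using a'
      by (intro mult_right_mono d(2) L2_norm_nonneg) (simp add: dist_norm norm_minus_commute)
    also have "\<dots> \<le> e/2" using L2_norm_nonneg[of g] e by (simp add: field_simps add_nonneg_pos)
    finally have "cmod (L2_inner (translation a h) (modulation b g) - L2_inner (translation a' h) (modulation b g)) \<le> e/2"
      using h g by (subst L2_inner_diff_left[symmetric]) (auto intro: L2_translation L2_modulation)
    with 1 show "cmod (L2_inner (translation a h) (modulation b g)) \<le> e"
      using norm_triangle_ineq[of "L2_inner (translation a h) (modulation b g) - L2_inner (translation a' h) (modulation b g)"
         "L2_inner (translation a' h) (modulation b g)"] by simp
  qed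
qed

section \<open>Schwartz functions are square integrable\<close>

lemma integrable_inverse_1_plus_square_lborel: "integrable lborel (\<lambda>x::real. 1 / (1 + x\<^sup>2))"
  using integrable_inverse_1_plus_square by (simp add: set_integrable_def einterval_def divide_inverse)

lemma schwartz_continuous: "schwartz f \<Longrightarrow> continuous_on A f"
proof -
  assume "schwartz f"
  then have "f differentiable at x" for x
    unfolding schwartz_def by (metis iterated_partial.simps(1) empty_set empty_subsetI)
  then show ?thesis
    by (intro continuous_at_imp_continuous_on ballI differentiable_imp_continuous_within)
qed

text \<open>Decay of order \<open>DIM('a)\<close> makes the square comparable to the product of
  \<open>1 / (1 + (x \<bullet> b)\<^sup>2)\<close> over the coordinates: the product of the
  denominators is at most \<open>(1 + (norm x)\<^sup>2) ^ DIM('a)\<close>, hence at most a constant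
  times \<open>(1 + norm x ^ DIM('a))\<^sup>2\<close>.\<close>

lemma schwartz_L2:
  fixes f :: "'a::euclidean_space \<Rightarrow> complex"
  assumes f: "schwartz f" shows "f \<in> L2"
proof -
  let ?d = "DIM('a)"
  have [measurable]: "f \<in> borel_measurable borel"
    using schwartz_continuous[OF f] by (intro borel_measurable_continuous_onI)
  have "\<forall>k. \<exists>C. \<forall>x. norm x ^ k * cmod (f x) \<le> C"
    using f[unfolded schwartz_def, rule_format, of "[]"] by simp
  then obtain C where C: "\<And>k x. norm x ^ k * cmod (f x) \<le> C k" by metis
  define D where "D = C 0 + C ?d"
  have D: "(1 + norm x ^ ?d) * cmod (f x) \<le> D" for x
    using C[of x 0] C[of x ?d] by (simp add: D_def algebra_simps)
  have bd: "(cmod (f x))\<^sup>2 \<le> 2 ^ ?d * D\<^sup>2 * (\<Prod>b\<in>Basis. 1 / (1 + (x \<bullet> b)\<^sup>2))" for x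
  proof -
    have "(\<Prod>b\<in>Basis. 1 + (x \<bullet> b)\<^sup>2) \<le> (\<Prod>b\<in>(Basis::'a set). 1 + (norm x)\<^sup>2)"
      by (intro prod_mono) (auto simp: Basis_le_norm abs_le_square_iff[symmetric])
    also have "\<dots> = (1 + (norm x)\<^sup>2) ^ ?d" by simp
    also have "\<dots> \<le> (2 * max 1 ((norm x)\<^sup>2)) ^ ?d" by (intro power_mono) auto
    also have "\<dots> = 2 ^ ?d * (max 1 ((norm x)\<^sup>2)) ^ ?d" by (simp add: power_mult_distrib)
    also have "(max 1 ((norm x)\<^sup>2)) ^ ?d \<le> (1 + norm x ^ ?d)\<^sup>2"
    proof (cases "(norm x)\<^sup>2 \<le> 1")
      case True 
      then have "max 1 ((norm x)\<^sup>2) = 1" by simp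
      then show ?thesis by (simp add: one_le_power)
    next
      case False 
      then have "(max 1 ((norm x)\<^sup>2)) ^ ?d = (norm x ^ ?d)\<^sup>2" by (simp add: max_def flip: power_mult add: mult.commute)
      also have "\<dots> \<le> (1 + norm x ^ ?d)\<^sup>2" by (intro power_mono) auto
      finally show ?thesis .
    qed
    finally have 1: "(\<Prod>b\<in>Basis. 1 + (x \<bullet> b)\<^sup>2) \<le> 2 ^ ?d * (1 + norm x ^ ?d)\<^sup>2" by simp
    have pos: "(\<Prod>b\<in>Basis. 1 + (x \<bullet> b)\<^sup>2) > 0" by (intro prod_pos) (auto simp: add_pos_nonneg)
    have "(cmod (f x))\<^sup>2 * (\<Prod>b\<in>Basis. 1 + (x \<bullet> b)\<^sup>2) \<le> (cmod (f x))\<^sup>2 * (2 ^ ?d * (1 + norm x ^ ?d)\<^sup>2)"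
      by (intro mult_left_mono 1) auto
    also have "\<dots> = 2 ^ ?d * ((1 + norm x ^ ?d) * cmod (f x))\<^sup>2" by (simp add: power_mult_distrib)
    also have "\<dots> \<le> 2 ^ ?d * D\<^sup>2" using D[of x] by (intro mult_left_mono power_mono) auto
    finally show ?thesis using pos by (simp add: prod_dividef field_simps)
  qed
  have "integrable lborel (\<lambda>x::'a. 2 ^ ?d * D\<^sup>2 * (\<Prod>b\<in>Basis. 1 / (1 + (x \<bullet> b)\<^sup>2)))"
    by (intro integrable_mult_right integrable_lborel_prod_Basis[of "\<lambda>b x. 1 / (1 + x\<^sup>2)"] integrable_inverse_1_plus_square_lborel)
  then have "integrable lborel (\<lambda>x. (cmod (f x))\<^sup>2)"
    by (rule Bochner_Integration.integrable_bound) (use bd in \<open>auto intro: order_trans[OF _ abs_ge_self]\<close>)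
  then show ?thesis by (simp add: L2_def)
qed

section \<open>Amalgam norms\<close>

text \<open>The half-open cubes of side \<open>s\<close> are the fibres of this map. Indexing them
  by the countable group of integer vectors turns sums over cubes into integrals over a counting
  measure and makes convolution over cubes available.\<close>

definition cell :: "real \<Rightarrow> real ^ 'd \<Rightarrow> int ^ 'd" where
  "cell s x = (\<chi> i. \<lfloor>x $ i / s\<rfloor>)"

lemma measurable_cell [measurable]: "cell s \<in> borel \<rightarrow>\<^sub>M count_space UNIV"
proof -
  have "cell s -` {k} \<in> sets borel" for k :: "int ^ 'd"
  proof -
    have "Measurable.pred borel (\<lambda>x :: real ^ 'd. \<forall>i. \<lfloor>x $ i / s\<rfloor> = k $ i)"
      by measurable
    moreover have "cell s -` {k} = {x. \<forall>i. \<lfloor>x $ i / s\<rfloor> = k $ i}"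
      by (auto simp: cell_def vec_eq_iff)
    ultimately show ?thesis by (simp add: pred_def)
  qed
  then show ?thesis
    by (subst measurable_count_space_eq2_countable) auto
qed

lemma nn_integral_fibres:
  fixes \<phi> :: "'a \<Rightarrow> 'k::countable"
  assumes [measurable]: "\<phi> \<in> M \<rightarrow>\<^sub>M count_space UNIV" "f \<in> borel_measurable M"
  shows "(\<integral>\<^sup>+x. f x \<partial>M) = (\<integral>\<^sup>+k. (\<integral>\<^sup>+x. f x * indicator {k} (\<phi> x) \<partial>M) \<partial>count_space UNIV)"
proof -
  have "(\<integral>\<^sup>+k. (\<integral>\<^sup>+x. f x * indicator {k} (\<phi> x) \<partial>M) \<partial>count_space UNIV) =
     (\<integral>\<^sup>+x. (\<integral>\<^sup>+k. f x * indicator {k} (\<phi> x) \<partial>count_space UNIV) \<partial>M)"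
    by (rule nn_integral_count_space_nn_integral[symmetric]) auto
  also have "(\<lambda>x. \<integral>\<^sup>+k. f x * indicator {k} (\<phi> x) \<partial>count_space UNIV) = f"
  proof
    fix x
    have "(\<integral>\<^sup>+k. f x * indicator {k} (\<phi> x) \<partial>count_space UNIV) = (\<integral>\<^sup>+k. f x * indicator {\<phi> x} k \<partial>count_space UNIV)"
      by (intro nn_integral_cong) (auto simp: indicator_def)
    also have "\<dots> = f x" by (simp add: nn_integral_cmult_indicator)
    finally show "(\<integral>\<^sup>+k. f x * indicator {k} (\<phi> x) \<partial>count_space UNIV) = f x" .
  qed
  finally show ?thesis by simp
qed

lemma nn_integral_indicator_comp:
  assumes [measurable]: "\<phi> \<in> borel \<rightarrow>\<^sub>M count_space UNIV"
  shows "(\<integral>\<^sup>+x. indicator E (\<phi> x) \<partial>lborel) = emeasure lborel {x. \<phi> x \<in> E}"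
proof -
  have "(\<lambda>x. indicator E (\<phi> x) :: ennreal) = indicator {x. \<phi> x \<in> E}"
    by (auto simp: indicator_def fun_eq_iff)
  moreover have "{x. \<phi> x \<in> E} \<in> sets lborel"
    using measurable_sets[OF assms, of E] by (simp add: vimage_def)
  ultimately show ?thesis by simp
qed

lemma cell_shift: "s > 0 \<Longrightarrow> cell s (x - s *\<^sub>R (\<chi> i. of_int (m $ i))) = cell s x - m"
  by (simp add: cell_def vec_eq_iff diff_divide_distrib)

text \<open>The factor \<open>CARD('d)\<close> comes from bounding the Euclidean norm by the l^1
  norm.\<close>

lemma norm_diff_less_of_cell_eq:
  fixes x y :: "real ^ 'd"
  assumes s: "s > 0" "s * real CARD('d) \<le> r" and eq: "cell s x = cell s y"
  shows "norm (x - y) < r"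
proof -
  have *: "\<bar>(x - y) $ i\<bar> < s" for i
  proof -
    have "\<lfloor>x $ i / s\<rfloor> = \<lfloor>y $ i / s\<rfloor>" using eq by (simp add: cell_def vec_eq_iff)
    then have "\<bar>x $ i / s - y $ i / s\<bar> < 1" by linarith
    then have "\<bar>x $ i - y $ i\<bar> / s < 1" using s by (simp add: abs_div_pos diff_divide_distrib)
    then show ?thesis using s by simp
  qed
  have "norm (x - y) \<le> (\<Sum>i\<in>UNIV. \<bar>(x - y) $ i\<bar>)" by (rule norm_le_l1_cart)
  also have "\<dots> < (\<Sum>i\<in>(UNIV::'d set). s)" by (intro sum_strict_mono *) auto
  also have "\<dots> \<le> r" using s by (simp add: mult.commute)
  finally show ?thesis .
qed

lemma bounded_cell_preimage:
  assumes s: "s > 0" and "finite (E :: (int ^ 'd) set)" 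
  shows "bounded {x. cell s x \<in> E}"
proof -
  have "bounded {x. cell s x = k}" for k :: "int ^ 'd"
  proof (cases "\<exists>y. cell s y = k")
    case True
    then obtain y where y: "cell s y = k" by auto
    have "norm (y - x) < s * real CARD('d)" if "cell s x = k" for x
      using that y by (intro norm_diff_less_of_cell_eq[OF s order_refl]) simp
    then have "{x. cell s x = k} \<subseteq> ball y (s * real CARD('d))"
      by (auto simp: dist_norm)
    then show ?thesis using bounded_ball bounded_subset by blast
  qed auto
  moreover have "{x. cell s x \<in> E} = (\<Union>k\<in>E. {x. cell s x = k})" by auto
  ultimately show ?thesis using assms by (metis bounded_UN)
qed

lemma emeasure_cell_shift:
  fixes m :: "int ^ 'd"
  assumes s: "s > 0"
  shows "emeasure lborel {x. cell s x - m \<in> E} = emeasure lborel {x. cell s x \<in> E}"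
proof -
  have "emeasure lborel {x. cell s x - m \<in> E} = (\<integral>\<^sup>+x. indicator E (cell s (x - s *\<^sub>R (\<chi> i. of_int (m $ i)))) \<partial>lborel)"
    unfolding cell_shift[OF s] by (rule nn_integral_indicator_comp[symmetric]) measurable
  also have "\<dots> = (\<integral>\<^sup>+x. indicator E (cell s x) \<partial>lborel)"
    by (rule nn_integral_lborel_shift) measurable
  also have "\<dots> = emeasure lborel {x. cell s x \<in> E}"
    by (rule nn_integral_indicator_comp) measurable
  finally show ?thesis .
qed

lemma emeasure_cell_finite: "s > 0 \<Longrightarrow> finite E \<Longrightarrow> emeasure lborel {x. cell s x \<in> E} < \<infinity>"
  by (intro emeasure_bounded_finite bounded_cell_preimage)

text \<open>All cells are translates of each other, so one null cell would make the whole space a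
  countable union of null sets.\<close>

lemma emeasure_cell_pos:
  assumes s: "s > 0"
  shows "emeasure lborel {x. cell s x = (k :: int ^ 'd)} > 0"
proof (rule ccontr)
  assume "\<not> ?thesis"
  then have z: "emeasure lborel {x. cell s x = k} = 0" by (simp add: zero_less_iff_neq_zero)
  have eq: "emeasure lborel {x. cell s x = m} = emeasure lborel {x. cell s x = (0 :: int ^ 'd)}" for m :: "int ^ 'd"
    using emeasure_cell_shift[OF s, of m "{0}"] by simp
  have z': "emeasure lborel {x. cell s x = m} = 0" for m :: "int ^ 'd"
    by (rule trans[OF eq[of m] trans[OF eq[of k, symmetric] z]])
  have "(\<integral>\<^sup>+x. 1 \<partial>(lborel :: (real ^ 'd) measure)) = 
     (\<integral>\<^sup>+m. (\<integral>\<^sup>+x. 1 * indicator {m} (cell s x) \<partial>lborel) \<partial>count_space (UNIV :: (int ^ 'd) set))"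
    by (rule nn_integral_fibres) auto
  also have "\<dots> = (\<integral>\<^sup>+m. emeasure lborel {x. cell s x = m} \<partial>count_space (UNIV :: (int ^ 'd) set))"
    using nn_integral_indicator_comp[of "cell s :: real ^ 'd \<Rightarrow> _"] by (intro nn_integral_cong) simp
  also have "\<dots> = 0" by (simp add: z')
  finally show False by simp
qed

text \<open>\<open>W x\<close> is the L^1 norm of the slice of \<open>STFT \<psi> g\<close> at
  position \<open>x\<close>. For almost every \<open>x\<close> this slice is integrable, and it is
  the Fourier transform of \<open>g\<close> times the conjugate of the window translated by
  \<open>x\<close>, so its norm bounds that product. Tonelli makes \<open>W\<close>
  integrable.\<close>

lemma feichtinger_algebra_local_bound:
  fixes g \<psi> :: "'a::euclidean_space \<Rightarrow> complex"
  assumes \<psi>: "schwartz \<psi>" and g: "g \<in> feichtinger_algebra \<psi>"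
  shows "\<exists>W. W \<in> borel_measurable borel \<and> (\<integral>\<^sup>+x. W x \<partial>lborel) < \<infinity> \<and>
     (AE x in lborel. AE t in lborel. ennreal (cmod (g t) * cmod (\<psi> (t - x))) \<le> W x)"
proof -
  have gL: "g \<in> L2" and int: "integrable (lborel \<Otimes>\<^sub>M lborel) (STFT \<psi> g)"
    using g by (auto simp: feichtinger_algebra_def lborel_prod)
  note [measurable] = borel_measurable_integrable[OF int] L2_borel[OF gL] L2_borel[OF schwartz_L2[OF \<psi>]]
  define W where "W x = (\<integral>\<^sup>+w. ennreal (cmod (STFT \<psi> g (x, w))) \<partial>lborel)" for x
  have [measurable]: "W \<in> borel_measurable borel" unfolding W_def by measurable
  have "(\<integral>\<^sup>+x. W x \<partial>lborel) = (\<integral>\<^sup>+z. ennreal (cmod (STFT \<psi> g z)) \<partial>(lborel \<Otimes>\<^sub>M lborel))"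
    unfolding W_def by (rule lborel.nn_integral_fst) measurable
  also have "\<dots> < \<infinity>" using int by (simp add: integrable_iff_bounded)
  finally have fin: "(\<integral>\<^sup>+x. W x \<partial>lborel) < \<infinity>" .
  have "AE x in lborel. integrable lborel (\<lambda>w. STFT \<psi> g (x, w))"
    using lborel_pair.AE_integrable_fst'[OF int] .
  then have "AE x in lborel. AE t in lborel. ennreal (cmod (g t) * cmod (\<psi> (t - x))) \<le> W x"
  proof (rule eventually_mono)
    fix x assume ix: "integrable lborel (\<lambda>w. STFT \<psi> g (x, w))"
    let ?F = "\<lambda>t. g t * cnj (translation x \<psi> t)"
    have iF: "integrable lborel ?F"
      by (intro integrable_L2_mult gL L2_translation schwartz_L2 \<psi>)
    have eq: "fourier ?F = (\<lambda>w. STFT \<psi> g (x, w))"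
      by (auto simp: fourier_def STFT_def L2_inner_def modulation_cis cis_cnj fun_eq_iff
          intro!: Bochner_Integration.integral_cong)
    have "ennreal (\<integral>w. cmod (STFT \<psi> g (x, w)) \<partial>lborel) = W x"
      unfolding W_def using ix by (intro nn_integral_eq_integral[symmetric]) auto
    moreover have "AE t in lborel. cmod (?F t) \<le> (\<integral>w. cmod (STFT \<psi> g (x, w)) \<partial>lborel)"
      using AE_norm_le_integral_fourier[OF iF] ix unfolding eq by simp
    ultimately show "AE t in lborel. ennreal (cmod (g t) * cmod (\<psi> (t - x))) \<le> W x"
      by (auto simp: norm_mult translation_def elim!: eventually_mono dest!: ennreal_leI)
  qed
  then show ?thesis using fin by (intro exI[of _ W]) auto
qed

text \<open>Near a point \<open>z0\<close> the window is at least \<open>c\<close> in modulus. If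
  \<open>t\<close> and \<open>x + z0\<close> share a small cell, then \<open>W x\<close> bounds
  \<open>c * cmod (g t)\<close>; averaging over all such \<open>x\<close> bounds \<open>g\<close> on
  the cell by a local mean of \<open>W\<close>, and these means are summable. Every cell size up to
  \<open>s0\<close> is allowed, since the same cells must later also be small enough for the
  translates of \<open>h\<close>.\<close>

lemma feichtinger_algebra_amalgam:
  fixes g \<psi> :: "real ^ 'd \<Rightarrow> complex"
  assumes \<psi>: "schwartz \<psi>" "\<psi> \<noteq> (\<lambda>x. 0)" and g: "g \<in> feichtinger_algebra \<psi>"
  shows "\<exists>s0>0. \<forall>s. 0 < s \<and> s \<le> s0 \<longrightarrow> (\<exists>G :: int ^ 'd \<Rightarrow> ennreal.
    (\<integral>\<^sup>+k. G k \<partial>count_space UNIV) < \<infinity> \<and> (AE x in lborel. ennreal (cmod (g x)) \<le> G (cell s x)))"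
proof -
  obtain W where W[measurable]: "W \<in> borel_measurable borel" and Wfin: "(\<integral>\<^sup>+x. W x \<partial>lborel) < \<infinity>"
    and WAE: "AE x in lborel. AE t in lborel. ennreal (cmod (g t) * cmod (\<psi> (t - x))) \<le> W x"
    using feichtinger_algebra_local_bound[OF \<psi>(1) g] by auto
  have [measurable]: "g \<in> borel_measurable borel"
    using g by (auto simp: feichtinger_algebra_def)
  obtain z0 where z0: "\<psi> z0 \<noteq> 0" using \<psi>(2) by auto
  define c where "c = cmod (\<psi> z0) / 2"
  have c: "c > 0" using z0 by (simp add: c_def)
  obtain r where r: "r > 0" "\<And>z. norm (z - z0) < r \<Longrightarrow> cmod (\<psi> z) \<ge> c"
  proof -
    have "isCont \<psi> z0" using schwartz_continuous[OF \<psi>(1), of UNIV] by (simp add: continuous_on_eq_continuous_at)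
    then obtain r where r: "r > 0" "\<And>z. dist z z0 < r \<Longrightarrow> dist (\<psi> z) (\<psi> z0) < c"
      using c unfolding continuous_at_eps_delta by (auto simp: dist_commute)
    have "cmod (\<psi> z) \<ge> c" if "norm (z - z0) < r" for z
      using r(2)[of z] that norm_triangle_ineq2[of "\<psi> z0" "\<psi> z"] 
      by (simp add: dist_norm norm_minus_commute c_def)
    with r(1) show ?thesis by (rule that)
  qed
  show ?thesis
  proof (intro exI[of _ "r / real CARD('d)"] conjI allI impI)
    fix s :: real assume s: "0 < s \<and> s \<le> r / real CARD('d)"
    then have s0: "s > 0" and sr: "s * real CARD('d) \<le> r" by (auto simp: field_simps)
    \<comment> \<open>The common volume of the cells, by which the averages are normalised.\<close>
    define q where "q = emeasure lborel {x. cell s x = (0 :: int ^ 'd)}"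
    have q: "q > 0" "q < \<infinity>"
      unfolding q_def using emeasure_cell_pos[OF s0] emeasure_cell_finite[OF s0, of "{0 :: int ^ 'd}"] by auto
    define w where "w k = (\<integral>\<^sup>+x. W x * indicator {k} (cell s (x + z0)) \<partial>lborel)" for k :: "int ^ 'd"
    have sumw: "(\<integral>\<^sup>+k. w k \<partial>count_space UNIV) = (\<integral>\<^sup>+x. W x \<partial>lborel)"
      unfolding w_def by (rule nn_integral_fibres[symmetric]) measurable
    have cell_measure: "(\<integral>\<^sup>+x. indicator {k} (cell s (x + z0)) \<partial>lborel) = q" for k :: "int ^ 'd"
    proof -
      have "(\<integral>\<^sup>+x. indicator {k} (cell s (x - (- z0))) \<partial>lborel) = (\<integral>\<^sup>+x. indicator {k} (cell s x) \<partial>lborel)"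
        by (rule nn_integral_lborel_shift) measurable
      also have "\<dots> = emeasure lborel {x. cell s x - k \<in> {0}}"
        by (subst nn_integral_indicator_comp) auto
      finally show ?thesis using emeasure_cell_shift[OF s0, of k "{0}"] by (simp add: q_def)
    qed
    have AE1: "AE x in lborel. AE t in lborel. cell s t = k \<and> cell s (x + z0) = k \<longrightarrow> ennreal (c * cmod (g t)) \<le> W x" for k :: "int ^ 'd"
      using WAE
    proof (rule eventually_mono)
      fix x assume "AE t in lborel. ennreal (cmod (g t) * cmod (\<psi> (t - x))) \<le> W x"
      then show "AE t in lborel. cell s t = k \<and> cell s (x + z0) = k \<longrightarrow> ennreal (c * cmod (g t)) \<le> W x"
      proof (rule AE_mp, intro AE_I2 impI)
        fix t assume le: "ennreal (cmod (g t) * cmod (\<psi> (t - x))) \<le> W x" and k: "cell s t = k \<and> cell s (x + z0) = k"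
        have "norm (t - (x + z0)) < r" using k by (intro norm_diff_less_of_cell_eq[OF s0 sr]) simp
        then have "c \<le> cmod (\<psi> (t - x))" by (intro r(2)) (simp add: algebra_simps)
        then have "c * cmod (g t) \<le> cmod (g t) * cmod (\<psi> (t - x))"
          using mult_right_mono[of c "cmod (\<psi> (t - x))" "cmod (g t)"] by (simp add: mult.commute)
        then show "ennreal (c * cmod (g t)) \<le> W x" using le ennreal_leI order_trans by blast
      qed
    qed
    define G where "G k = w k / (ennreal c * q)" for k
    have cq: "ennreal c * q \<noteq> 0" "ennreal c * q < \<infinity>" using c q by (auto simp: ennreal_mult_less_top)
    have AE2: "AE t in lborel. cell s t = k \<longrightarrow> ennreal (cmod (g t)) \<le> G k" for k
    proof -
      \<comment> \<open>The exceptional null set of \<open>t\<close> depends on \<open>x\<close>.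
        Exchanging the two quantifiers makes it possible to fix \<open>t\<close> and integrate over
        \<open>x\<close>.\<close>
      have "AE t in lborel. AE x in lborel. cell s t = k \<and> cell s (x + z0) = k \<longrightarrow> ennreal (c * cmod (g t)) \<le> W x"
      proof (rule lborel_pair.AE_commute[THEN iffD1, OF _ AE1])
        show "{x \<in> space (lborel \<Otimes>\<^sub>M lborel). cell s (snd x) = k \<and> cell s (fst x + z0) = k \<longrightarrow> ennreal (c * cmod (g (snd x))) \<le> W (fst x)} \<in> sets (lborel \<Otimes>\<^sub>M lborel)"
          by measurable
      qed
      then show ?thesis
      proof (rule AE_mp, intro AE_I2 impI)
        fix t assume ae: "AE x in lborel. cell s t = k \<and> cell s (x + z0) = k \<longrightarrow> ennreal (c * cmod (g t)) \<le> W x"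
          and k: "cell s t = k"
        have "ennreal (c * cmod (g t)) * q = (\<integral>\<^sup>+x. ennreal (c * cmod (g t)) * indicator {k} (cell s (x + z0)) \<partial>lborel)"
          by (subst nn_integral_cmult) (auto simp: cell_measure)
        also have "\<dots> \<le> w k"
          unfolding w_def using ae k by (intro nn_integral_mono_AE) (auto elim!: eventually_mono simp: indicator_def)
        finally have "ennreal (cmod (g t)) * (ennreal c * q) \<le> w k"
          using c by (simp add: ennreal_mult ac_simps)
        then have "ennreal (cmod (g t)) * (ennreal c * q) / (ennreal c * q) \<le> G k"
          unfolding G_def by (rule divide_right_mono_ennreal)
        then show "ennreal (cmod (g t)) \<le> G k"
          using cq by (simp add: ennreal_mult_divide_eq)
      qed
    qed
    then have "AE t in lborel. \<forall>k. cell s t = k \<longrightarrow> ennreal (cmod (g t)) \<le> G k"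
      by (subst AE_all_countable) (rule allI)
    then have "AE t in lborel. ennreal (cmod (g t)) \<le> G (cell s t)" by (rule eventually_mono) blast
    moreover have "(\<integral>\<^sup>+k. G k \<partial>count_space UNIV) < \<infinity>"
    proof -
      have "(\<integral>\<^sup>+k. G k \<partial>count_space UNIV) = (\<integral>\<^sup>+x. W x \<partial>lborel) / (ennreal c * q)"
        unfolding G_def by (simp add: nn_integral_divide sumw)
      moreover have "\<dots> \<noteq> top" using Wfin cq by (auto simp: ennreal_divide_eq_top_iff)
      ultimately show ?thesis by (simp add: less_top)
    qed
    ultimately show "\<exists>G :: int ^ 'd \<Rightarrow> ennreal.
      (\<integral>\<^sup>+k. G k \<partial>count_space UNIV) < \<infinity> \<and> (AE x in lborel. ennreal (cmod (g x)) \<le> G (cell s x))" by blast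
  qed (use r in simp)
qed

text \<open>The case l^1 with l^2 of Young's inequality, for a correlation. Cauchy-Schwarz with
  respect to the measure of density \<open>G\<close> costs one factor \<open>S\<close>; summing over
  \<open>j\<close> first, with \<open>k - j\<close> as new variable, yields \<open>T\<close> and a
  second factor \<open>S\<close>.\<close>

lemma Young_convolution_count_space:
  fixes G \<theta> :: "'k::{countable, ab_group_add} \<Rightarrow> ennreal"
  shows "(\<integral>\<^sup>+j. (\<integral>\<^sup>+k. G k * \<theta> (k - j) \<partial>count_space UNIV)\<^sup>2 \<partial>count_space UNIV) \<le>
    (\<integral>\<^sup>+k. G k \<partial>count_space UNIV)\<^sup>2 * (\<integral>\<^sup>+k. (\<theta> k)\<^sup>2 \<partial>count_space UNIV)"
proof -
  let ?C = "count_space (UNIV :: 'k set)"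
  define S T where "S = (\<integral>\<^sup>+k. G k \<partial>?C)" and "T = (\<integral>\<^sup>+k. (\<theta> k)\<^sup>2 \<partial>?C)"
  have CS: "(\<integral>\<^sup>+k. G k * \<theta> (k - j) \<partial>?C)\<^sup>2 \<le> S * (\<integral>\<^sup>+k. G k * (\<theta> (k - j))\<^sup>2 \<partial>?C)" for j
    using Cauchy_Schwarz_nn_integral[of "\<lambda>_. 1" "density ?C G" "\<lambda>k. \<theta> (k - j)"]
    by (simp add: nn_integral_density S_def emeasure_density)
  have "(\<integral>\<^sup>+j. (\<integral>\<^sup>+k. G k * \<theta> (k - j) \<partial>?C)\<^sup>2 \<partial>?C) \<le> (\<integral>\<^sup>+j. S * (\<integral>\<^sup>+k. G k * (\<theta> (k - j))\<^sup>2 \<partial>?C) \<partial>?C)"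
    by (intro nn_integral_mono CS)
  also have "\<dots> = S * (\<integral>\<^sup>+j. (\<integral>\<^sup>+k. G k * (\<theta> (k - j))\<^sup>2 \<partial>?C) \<partial>?C)"
    by (simp add: nn_integral_cmult)
  also have "(\<integral>\<^sup>+j. (\<integral>\<^sup>+k. G k * (\<theta> (k - j))\<^sup>2 \<partial>?C) \<partial>?C) = (\<integral>\<^sup>+k. (\<integral>\<^sup>+j. G k * (\<theta> (k - j))\<^sup>2 \<partial>?C) \<partial>?C)"
    by (rule nn_integral_count_space_nn_integral) auto
  also have "\<dots> = (\<integral>\<^sup>+k. G k * T \<partial>?C)"
  proof (intro nn_integral_cong)
    fix k
    have "bij_betw (\<lambda>j. k - j) UNIV (UNIV :: 'k set)"
      by (rule bij_betwI[of _ _ _ "\<lambda>j. k - j"]) auto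
    from nn_integral_bij_count_space[OF this, of "\<lambda>j. (\<theta> j)\<^sup>2"]
    show "(\<integral>\<^sup>+j. G k * (\<theta> (k - j))\<^sup>2 \<partial>?C) = G k * T" by (simp add: nn_integral_cmult T_def)
  qed
  also have "\<dots> = S * T" by (simp add: nn_integral_multc S_def)
  finally show ?thesis by (simp add: S_def T_def power2_eq_square mult.assoc)
qed

text \<open>The floor of a sum exceeds the sum of the floors by a carry of 0 or 1 in each
  coordinate.\<close>

lemma cell_diff_range:
  assumes "cell s (x + a) = k" "cell s a = j"
  shows "cell s x - (k - j) \<in> {e. \<forall>i. e $ i \<in> {-1, 0 :: int}}"
proof -
  have "\<lfloor>x $ i / s\<rfloor> - (k $ i - j $ i) \<in> {-1, 0}" for i
  proof -
    have "k $ i = \<lfloor>x $ i / s + a $ i / s\<rfloor>" "j $ i = \<lfloor>a $ i / s\<rfloor>"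
      using assms by (auto simp: cell_def add_divide_distrib)
    then have "\<lfloor>x $ i / s\<rfloor> - (k $ i - j $ i) = -1 \<or> \<lfloor>x $ i / s\<rfloor> - (k $ i - j $ i) = 0" by linarith
    then show ?thesis by simp
  qed
  then show ?thesis by (simp add: cell_def)
qed

text \<open>On cell \<open>k\<close> the function \<open>g\<close> is at most \<open>G k\<close>,
  while \<open>x - a\<close> lies in one of the few cells next to \<open>k - cell s a\<close>. The
  integral is thus at most a correlation of \<open>G\<close> with the local masses
  \<open>\<theta>\<close> of \<open>h\<close>. Only moduli enter, so the same \<open>D\<close>
  serves all modulations of \<open>g\<close>.\<close>

lemma amalgam_correlation_bound:
  fixes g h :: "real ^ 'd \<Rightarrow> complex" and G :: "int ^ 'd \<Rightarrow> ennreal"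
  assumes s: "s > 0" and g: "g \<in> L2" and h: "h \<in> L2"
    and G: "(\<integral>\<^sup>+k. G k \<partial>count_space UNIV) < \<infinity>" and gG: "AE x in lborel. ennreal (cmod (g x)) \<le> G (cell s x)"
  shows "\<exists>D :: int ^ 'd \<Rightarrow> ennreal. (\<integral>\<^sup>+k. (D k)\<^sup>2 \<partial>count_space UNIV) < \<infinity> \<and>
    (\<forall>a. (\<integral>\<^sup>+x. ennreal (cmod (translation a h x)) * ennreal (cmod (g x)) \<partial>lborel) \<le> D (cell s a))"
proof -
  let ?C = "count_space (UNIV :: (int ^ 'd) set)"
  note [measurable] = L2_borel[OF g] L2_borel[OF h]
  \<comment> \<open>The possible carries: seen from \<open>m\<close>, the local mass
    \<open>\<theta> m\<close> collects \<open>h\<close> over the cells \<open>m + e\<close> with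
    \<open>e\<close> in \<open>E\<close>.\<close>
  define E :: "(int ^ 'd) set" where "E = {e. \<forall>i. e $ i \<in> {-1, 0}}"
  have finE: "finite E"
  proof (rule finite_subset)
    show "E \<subseteq> vec_lambda ` (UNIV \<rightarrow> {-1, 0})"
    proof
      fix e assume "e \<in> E"
      then show "e \<in> vec_lambda ` (UNIV \<rightarrow> {-1, 0})"
        by (intro image_eqI[of _ _ "vec_nth e"]) (auto simp: E_def)
    qed
    have "finite (PiE (UNIV :: 'd set) (\<lambda>_. {-1, 0 :: int}))" by (intro finite_PiE) auto
    then show "finite (vec_lambda ` ((UNIV :: 'd set) \<rightarrow> {-1, 0 :: int}))" by (simp add: PiE_UNIV_domain)
  qed
  define \<theta> where "\<theta> m = (\<integral>\<^sup>+x. ennreal (cmod (h x)) * indicator E (cell s x - m) \<partial>lborel)" for m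
  define q where "q = emeasure lborel {x. cell s x \<in> E}"
  have q: "q < \<infinity>" unfolding q_def by (rule emeasure_cell_finite[OF s finE])
  have \<theta>2: "(\<theta> m)\<^sup>2 \<le> q * (\<integral>\<^sup>+x. (ennreal (cmod (h x)))\<^sup>2 * indicator E (cell s x - m) \<partial>lborel)" for m
  proof -
    have "(\<theta> m)\<^sup>2 = (\<integral>\<^sup>+x. indicator E (cell s x - m) * (ennreal (cmod (h x)) * indicator E (cell s x - m)) \<partial>lborel)\<^sup>2"
      unfolding \<theta>_def by (intro arg_cong[where f="\<lambda>x. x\<^sup>2"] nn_integral_cong) (auto simp: indicator_def)
    also have "\<dots> \<le> (\<integral>\<^sup>+x. (indicator E (cell s x - m))\<^sup>2 \<partial>lborel) * (\<integral>\<^sup>+x. (ennreal (cmod (h x)) * indicator E (cell s x - m))\<^sup>2 \<partial>lborel)"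
      by (rule Cauchy_Schwarz_nn_integral) measurable
    also have "(\<integral>\<^sup>+x. (indicator E (cell s x - m))\<^sup>2 \<partial>lborel) = (\<integral>\<^sup>+x. indicator E (cell s x - m) \<partial>lborel)"
      by (intro nn_integral_cong) (auto simp: indicator_def)
    also have "\<dots> = emeasure lborel {x. cell s x - m \<in> E}"
      by (rule nn_integral_indicator_comp) measurable
    also have "\<dots> = q" unfolding q_def by (rule emeasure_cell_shift[OF s])
    also have "(\<integral>\<^sup>+x. (ennreal (cmod (h x)) * indicator E (cell s x - m))\<^sup>2 \<partial>lborel) = 
       (\<integral>\<^sup>+x. (ennreal (cmod (h x)))\<^sup>2 * indicator E (cell s x - m) \<partial>lborel)"
      by (intro nn_integral_cong) (auto simp: indicator_def)
    finally show ?thesis .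
  qed
  \<comment> \<open>Each cell belongs to exactly \<open>card E\<close> of these clusters, so summing
    the local L^2 masses over \<open>m\<close> counts the norm of \<open>h\<close> that many
    times.\<close>
  have count: "(\<integral>\<^sup>+m. indicator E (k - m) \<partial>?C) = of_nat (card E)" for k
  proof -
    have "bij_betw (\<lambda>j. k - j) UNIV (UNIV :: (int ^ 'd) set)"
      by (rule bij_betwI[of _ _ _ "\<lambda>j. k - j"]) auto
    from nn_integral_bij_count_space[OF this, of "indicator E"]
    have "(\<integral>\<^sup>+m. indicator E (k - m) \<partial>?C) = emeasure ?C E" by simp
    then show ?thesis using finE by (simp add: emeasure_count_space)
  qed
  have "(\<integral>\<^sup>+m. (\<theta> m)\<^sup>2 \<partial>?C) \<le> (\<integral>\<^sup>+m. q * (\<integral>\<^sup>+x. (ennreal (cmod (h x)))\<^sup>2 * indicator E (cell s x - m) \<partial>lborel) \<partial>?C)"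
    by (intro nn_integral_mono \<theta>2)
  also have "\<dots> = q * (\<integral>\<^sup>+m. (\<integral>\<^sup>+x. (ennreal (cmod (h x)))\<^sup>2 * indicator E (cell s x - m) \<partial>lborel) \<partial>?C)"
    by (simp add: nn_integral_cmult)
  also have "(\<integral>\<^sup>+m. (\<integral>\<^sup>+x. (ennreal (cmod (h x)))\<^sup>2 * indicator E (cell s x - m) \<partial>lborel) \<partial>?C) = 
     (\<integral>\<^sup>+x. (\<integral>\<^sup>+m. (ennreal (cmod (h x)))\<^sup>2 * indicator E (cell s x - m) \<partial>?C) \<partial>lborel)"
    by (rule nn_integral_count_space_nn_integral[symmetric]) auto
  also have "\<dots> = (\<integral>\<^sup>+x. (ennreal (cmod (h x)))\<^sup>2 \<partial>lborel) * of_nat (card E)"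
    by (simp add: nn_integral_cmult count nn_integral_multc)
  also have "\<dots> = ennreal ((L2_norm h)\<^sup>2) * of_nat (card E)" by (simp add: L2_norm_power2_ennreal[OF h])
  also have "q * \<dots> < \<infinity>" using q by (simp add: ennreal_mult_less_top of_nat_less_top)
  finally have \<theta>fin: "(\<integral>\<^sup>+m. (\<theta> m)\<^sup>2 \<partial>?C) < \<infinity>" .
  define D where "D j = (\<integral>\<^sup>+k. G k * \<theta> (k - j) \<partial>?C)" for j
  have "(\<integral>\<^sup>+j. (D j)\<^sup>2 \<partial>?C) \<le> (\<integral>\<^sup>+k. G k \<partial>?C)\<^sup>2 * (\<integral>\<^sup>+k. (\<theta> k)\<^sup>2 \<partial>?C)"
    unfolding D_def by (rule Young_convolution_count_space)
  also have "\<dots> < \<infinity>" using G \<theta>fin by (simp add: ennreal_mult_less_top power_less_top_ennreal)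
  finally have Dfin: "(\<integral>\<^sup>+j. (D j)\<^sup>2 \<partial>?C) < \<infinity>" .
  have bound: "(\<integral>\<^sup>+x. ennreal (cmod (translation a h x)) * ennreal (cmod (g x)) \<partial>lborel) \<le> D (cell s a)" for a
  proof -
    have "(\<integral>\<^sup>+x. ennreal (cmod (translation a h x)) * ennreal (cmod (g x)) \<partial>lborel) \<le>
        (\<integral>\<^sup>+x. ennreal (cmod (h (x - a))) * G (cell s x) \<partial>lborel)"
      using gG by (intro nn_integral_mono_AE) (auto simp: translation_def elim!: eventually_mono intro!: mult_left_mono)
    also have "\<dots> = (\<integral>\<^sup>+k. (\<integral>\<^sup>+x. ennreal (cmod (h (x - a))) * G (cell s x) * indicator {k} (cell s x) \<partial>lborel) \<partial>?C)"
      by (rule nn_integral_fibres) measurable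
    also have "\<dots> \<le> (\<integral>\<^sup>+k. G k * \<theta> (k - cell s a) \<partial>?C)"
    proof (intro nn_integral_mono)
      fix k
      have "(\<integral>\<^sup>+x. ennreal (cmod (h (x - a))) * G (cell s x) * indicator {k} (cell s x) \<partial>lborel) =
         (\<integral>\<^sup>+x. G k * (ennreal (cmod (h (x - a))) * indicator {k} (cell s (x - a + a))) \<partial>lborel)"
        by (intro nn_integral_cong) (auto simp: indicator_def mult.commute)
      also have "\<dots> = (\<integral>\<^sup>+x. G k * (ennreal (cmod (h x)) * indicator {k} (cell s (x + a))) \<partial>lborel)"
        by (rule nn_integral_lborel_shift) measurable
      also have "\<dots> = G k * (\<integral>\<^sup>+x. ennreal (cmod (h x)) * indicator {k} (cell s (x + a)) \<partial>lborel)"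
        by (rule nn_integral_cmult) measurable
      also have "\<dots> \<le> G k * \<theta> (k - cell s a)"
        unfolding \<theta>_def using cell_diff_range[of s _ a k "cell s a"]
        by (intro mult_left_mono nn_integral_mono) (auto simp: indicator_def E_def)
      finally show "(\<integral>\<^sup>+x. ennreal (cmod (h (x - a))) * G (cell s x) * indicator {k} (cell s x) \<partial>lborel)
         \<le> G k * \<theta> (k - cell s a)" .
    qed
    finally show ?thesis unfolding D_def .
  qed
  show ?thesis using Dfin bound by blast
qed

text \<open>Dominated convergence over the cells. Each term tends to 0 because a cell is bounded, so
  the Riemann-Lebesgue lemma is uniform on it.\<close>

lemma sup_inner_modulation_tendsto_0:
  fixes g h :: "real ^ 'd \<Rightarrow> complex" and G :: "int ^ 'd \<Rightarrow> ennreal" and b :: "nat \<Rightarrow> real ^ 'd"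
  assumes s: "s > 0" and g: "g \<in> L2" and h: "h \<in> L2"
    and G: "(\<integral>\<^sup>+k. G k \<partial>count_space UNIV) < \<infinity>" and gG: "AE x in lborel. ennreal (cmod (g x)) \<le> G (cell s x)"
    and b: "filterlim (\<lambda>n. norm (b n)) at_top sequentially"
  shows "(\<lambda>n. \<integral>\<^sup>+k. (SUP a\<in>{a. cell s a = k}. ennreal (cmod (L2_inner (translation a h) (modulation (b n) g))))\<^sup>2 \<partial>count_space UNIV)
    \<longlonglongrightarrow> 0"
proof -
  let ?C = "count_space (UNIV :: (int ^ 'd) set)"
  let ?E = "\<lambda>n k. SUP a\<in>{a. cell s a = k}. ennreal (cmod (L2_inner (translation a h) (modulation (b n) g)))"
  obtain D :: "int ^ 'd \<Rightarrow> ennreal" where D: "(\<integral>\<^sup>+k. (D k)\<^sup>2 \<partial>?C) < \<infinity>"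
    "\<And>a. (\<integral>\<^sup>+x. ennreal (cmod (translation a h x)) * ennreal (cmod (g x)) \<partial>lborel) \<le> D (cell s a)"
    using amalgam_correlation_bound[OF s g h G gG] by auto
  have inner_le: "ennreal (cmod (L2_inner (translation a h) (modulation (b n) g))) \<le> D (cell s a)" for a n
  proof -
    have "ennreal (cmod (L2_inner (translation a h) (modulation (b n) g))) \<le>
       (\<integral>\<^sup>+x. ennreal (norm (translation a h x * cnj (modulation (b n) g x))) \<partial>lborel)"
      unfolding L2_inner_def
      by (intro integral_norm_bound_ennreal integrable_L2_mult L2_translation L2_modulation g h)
    also have "\<dots> = (\<integral>\<^sup>+x. ennreal (cmod (translation a h x)) * ennreal (cmod (g x)) \<partial>lborel)"
      by (simp add: norm_mult ennreal_mult)
    finally show ?thesis using D(2)[of a] by simp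
  qed
  have lim: "(\<lambda>n. ?E n k) \<longlonglongrightarrow> 0" for k
  proof (rule order_tendstoI)
    fix y :: ennreal assume "y > 0"
    then obtain e where e: "e > 0" "ennreal e < y"
      using ennreal_rat_dense[of 0 y] by (metis ennreal_less_zero_iff)
    have "bounded {a. cell s a = k}" using bounded_cell_preimage[OF s, of "{k}"] by simp
    from Riemann_Lebesgue_translates[OF h g this e(1)] obtain R where
      R: "\<And>v a. norm v > R \<Longrightarrow> cell s a = k \<Longrightarrow> cmod (L2_inner (translation a h) (modulation v g)) \<le> e" by auto
    have "\<forall>\<^sub>F n in sequentially. norm (b n) > R" using b by (simp add: filterlim_at_top_dense)
    then show "\<forall>\<^sub>F n in sequentially. ?E n k < y"
    proof eventually_elim
      case (elim n)
      have "?E n k \<le> ennreal e" using R[OF elim] by (intro SUP_least ennreal_leI) auto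
      then show ?case using e by simp
    qed
  qed auto
  have "(\<lambda>n. \<integral>\<^sup>+k. (?E n k)\<^sup>2 \<partial>?C) \<longlonglongrightarrow> (\<integral>\<^sup>+k. 0 \<partial>?C)"
  proof (rule nn_integral_dominated_convergence[where w = "\<lambda>k. (D k)\<^sup>2"])
    show "AE k in ?C. (?E n k)\<^sup>2 \<le> (D k)\<^sup>2" for n
    proof (intro AE_I2 power_mono)
      show "?E n k \<le> D k" for k
        using inner_le[of _ n] by (intro SUP_least) auto
    qed auto
    show "AE k in ?C. (\<lambda>n. (?E n k)\<^sup>2) \<longlonglongrightarrow> 0"
    proof (intro AE_I2)
      fix k show "(\<lambda>n. (?E n k)\<^sup>2) \<longlonglongrightarrow> 0"
        using tendsto_mult_ennreal[OF lim[of k] lim[of k]] by (simp add: power2_eq_square)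
    qed
  qed (use D in auto)
  then show ?thesis by simp
qed

section \<open>Coefficients of unconditional expansions\<close>

text \<open>
  By the parallelogram law signs can be chosen one after the other so that the squared norm of the
  signed sum dominates the sum of the squared norms.
\<close>

lemma sum_norm_power2_le_of_subset_sums:
  assumes K: "finite K" and v: "\<And>k. k \<in> K \<Longrightarrow> v k \<in> L2"
    and B: "\<And>A. A \<subseteq> K \<Longrightarrow> L2_norm (\<lambda>x. \<Sum>k\<in>A. v k x) \<le> B"
  shows "(\<Sum>k\<in>K. (L2_norm (v k))\<^sup>2) \<le> 4 * B\<^sup>2"
proof -
  have "\<exists>A\<subseteq>K. (\<Sum>k\<in>K. (L2_norm (v k))\<^sup>2) \<le> (L2_norm (\<lambda>x. (\<Sum>k\<in>A. v k x) - (\<Sum>k\<in>K - A. v k x)))\<^sup>2"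
    using K v
  proof (induction K rule: finite_induct)
    case empty then show ?case by simp
  next
    case (insert k K)
    then obtain A where A: "A \<subseteq> K"
      "(\<Sum>k\<in>K. (L2_norm (v k))\<^sup>2) \<le> (L2_norm (\<lambda>x. (\<Sum>k\<in>A. v k x) - (\<Sum>k\<in>K - A. v k x)))\<^sup>2" by auto
    let ?u = "\<lambda>x. (\<Sum>k\<in>A. v k x) - (\<Sum>k\<in>K - A. v k x)"
    have fin: "finite A" "finite (K - A)" "k \<notin> A" using A insert finite_subset by auto
    have u: "?u \<in> L2" using insert A by (intro L2_diff L2_sum) auto
    have "(L2_norm (\<lambda>x. ?u x + v k x))\<^sup>2 + (L2_norm (\<lambda>x. ?u x - v k x))\<^sup>2 = 2 * (L2_norm ?u)\<^sup>2 + 2 * (L2_norm (v k))\<^sup>2"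
      using insert by (intro L2_parallelogram u) auto
    then consider "(L2_norm (\<lambda>x. ?u x + v k x))\<^sup>2 \<ge> (L2_norm ?u)\<^sup>2 + (L2_norm (v k))\<^sup>2"
      | "(L2_norm (\<lambda>x. ?u x - v k x))\<^sup>2 \<ge> (L2_norm ?u)\<^sup>2 + (L2_norm (v k))\<^sup>2" by linarith
    then show ?case
    proof cases
      case 1
      have "insert k K - insert k A = K - A" using insert by auto
      then have "(\<lambda>x. (\<Sum>k\<in>insert k A. v k x) - (\<Sum>k\<in>insert k K - insert k A. v k x)) = (\<lambda>x. ?u x + v k x)"
        using fin by (auto simp: fun_eq_iff)
      then show ?thesis using 1 A insert by (intro exI[of _ "insert k A"]) auto
    next
      case 2
      have "insert k K - A = insert k (K - A)" using fin by auto
      then have "(\<lambda>x. (\<Sum>k\<in>A. v k x) - (\<Sum>k\<in>insert k K - A. v k x)) = (\<lambda>x. ?u x - v k x)"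
        using fin insert by (auto simp: fun_eq_iff)
      then show ?thesis using 2 A insert by (intro exI[of _ A]) auto
    qed
  qed
  then obtain A where A: "A \<subseteq> K"
      "(\<Sum>k\<in>K. (L2_norm (v k))\<^sup>2) \<le> (L2_norm (\<lambda>x. (\<Sum>k\<in>A. v k x) - (\<Sum>k\<in>K - A. v k x)))\<^sup>2" by auto
  \<comment> \<open>A signed sum is a difference of two subset sums, hence the norm bound
    \<open>2 * B\<close> and the constant 4 after squaring.\<close>
  have "L2_norm (\<lambda>x. (\<Sum>k\<in>A. v k x) - (\<Sum>k\<in>K - A. v k x)) \<le> L2_norm (\<lambda>x. \<Sum>k\<in>A. v k x) + L2_norm (\<lambda>x. \<Sum>k\<in>K - A. v k x)"
    using A v by (intro L2_norm_triangle_diff L2_sum) auto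
  also have "\<dots> \<le> 2 * B" using B[of A] B[of "K - A"] A by auto
  finally have "(L2_norm (\<lambda>x. (\<Sum>k\<in>A. v k x) - (\<Sum>k\<in>K - A. v k x)))\<^sup>2 \<le> (2 * B)\<^sup>2"
    by (intro power_mono L2_norm_nonneg)
  then show ?thesis using A by (simp add: power_mult_distrib)
qed

text \<open>Pair the sum with a single translate \<open>translation a0 h\<close>. Each inner product
  is the squared norm of \<open>h\<close> up to a quarter of it, and after rotation by
  \<open>u\<close> each coefficient has real part at least half its modulus. Every term thus
  contributes at least \<open>1/2 - 1/4\<close> of its modulus times the squared norm, and nothing
  cancels.\<close>

lemma clustered_translates_lower_bound:
  assumes h: "h \<in> L2" and A: "finite A" and u: "cmod u = 1"
    and close: "\<And>a a'. a \<in> A \<Longrightarrow> a' \<in> A \<Longrightarrow> L2_norm (\<lambda>x. translation a h x - translation a' h x) \<le> L2_norm h / 4"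
    and sector: "\<And>a. a \<in> A \<Longrightarrow> Re (u * c a) \<ge> cmod (c a) / 2"
  shows "L2_norm h / 4 * (\<Sum>a\<in>A. cmod (c a)) \<le> L2_norm (\<lambda>x. \<Sum>a\<in>A. c a * translation a h x)"
proof (cases "A = {} \<or> L2_norm h = 0")
  case True then show ?thesis by (auto simp: L2_norm_nonneg)
next
  case False
  then obtain a0 where a0: "a0 \<in> A" by auto
  let ?w = "\<lambda>x. \<Sum>a\<in>A. c a * translation a h x" and ?n = "L2_norm h"
  have n: "?n > 0" using False L2_norm_nonneg[of h] by auto
  have T: "translation a h \<in> L2" for a by (rule L2_translation[OF h])
  have summand: "Re (u * (c a * L2_inner (translation a h) (translation a0 h))) \<ge> ?n\<^sup>2 / 4 * cmod (c a)" if a: "a \<in> A" for a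
  proof -
    define d where "d = L2_inner (\<lambda>x. translation a h x - translation a0 h x) (translation a0 h)"
    have "cmod d \<le> L2_norm (\<lambda>x. translation a h x - translation a0 h x) * ?n"
      unfolding d_def using L2_Cauchy_Schwarz[OF L2_diff[OF T T] T, of a a0 a0] by (simp add: L2_norm_translation[OF h])
    also have "\<dots> \<le> ?n / 4 * ?n" using n by (intro mult_right_mono close a a0) auto
    finally have d: "cmod d \<le> ?n\<^sup>2 / 4" by (simp add: power2_eq_square)
    have "L2_inner (translation a h) (translation a0 h) = complex_of_real (?n\<^sup>2) + d"
      unfolding d_def L2_inner_diff_left[OF T T T] L2_inner_self L2_norm_translation[OF h] by simp
    then have "u * (c a * L2_inner (translation a h) (translation a0 h)) = ?n\<^sup>2 *\<^sub>R (u * c a) + u * c a * d"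
      by (simp add: scaleR_conv_of_real algebra_simps)
    then have "Re (u * (c a * L2_inner (translation a h) (translation a0 h))) = ?n\<^sup>2 * Re (u * c a) + Re (u * c a * d)"
      by (simp only: plus_complex.sel scaleR_complex.sel)
    moreover have "\<bar>Re (u * c a * d)\<bar> \<le> cmod (c a) * (?n\<^sup>2 / 4)"
    proof -
      have "\<bar>Re (u * c a * d)\<bar> \<le> cmod (u * c a * d)" by (rule abs_Re_le_cmod)
      also have "\<dots> = cmod (c a) * cmod d" by (simp add: norm_mult u)
      also have "\<dots> \<le> cmod (c a) * (?n\<^sup>2 / 4)" using d by (intro mult_left_mono) auto
      finally show ?thesis .
    qed
    moreover have "?n\<^sup>2 * Re (u * c a) \<ge> ?n\<^sup>2 * (cmod (c a) / 2)"
      using sector[OF a] by (intro mult_left_mono) auto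
    moreover have "N / 4 * C \<le> R" if "R = N * X + Y" "\<bar>Y\<bar> \<le> C * (N / 4)" "N * X \<ge> N * (C / 2)" for N X Y C R :: real
      using that by (simp add: abs_le_iff mult.commute)
    ultimately show ?thesis by blast
  qed
  have "?n\<^sup>2 / 4 * (\<Sum>a\<in>A. cmod (c a)) \<le> (\<Sum>a\<in>A. Re (u * (c a * L2_inner (translation a h) (translation a0 h))))"
    unfolding sum_distrib_left by (intro sum_mono summand)
  also have "\<dots> = Re (u * L2_inner ?w (translation a0 h))"
    using T by (subst L2_inner_sum_left) (auto simp: L2_inner_scale_left sum_distrib_left intro: L2_scale)
  also have "\<dots> \<le> cmod (u * L2_inner ?w (translation a0 h))" by (rule complex_Re_le_cmod)
  also have "\<dots> \<le> L2_norm ?w * ?n"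
  proof -
    have "?w \<in> L2" by (intro L2_sum L2_scale T)
    then show ?thesis
      using L2_Cauchy_Schwarz[OF _ T, of ?w a0] by (simp add: norm_mult u L2_norm_translation[OF h])
  qed
  finally have "?n * (?n / 4 * (\<Sum>a\<in>A. cmod (c a))) \<le> ?n * L2_norm ?w" by (simp add: power2_eq_square mult.commute mult.assoc)
  then show ?thesis using n by simp
qed

lemma sum_over_fibres:
  assumes "finite F"
  shows "(\<Sum>k\<in>\<phi> ` F. \<Sum>a\<in>{a\<in>F. \<phi> a = k}. f a) = (\<Sum>a\<in>F. f a)"
  using sum.group[of F "\<phi> ` F" \<phi> f] assms by simp

lemma sum_UN_le:
  fixes f :: "'b \<Rightarrow> real"
  assumes "finite I" "\<And>i. i \<in> I \<Longrightarrow> finite (A i)" "\<And>a. f a \<ge> 0"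
  shows "(\<Sum>a\<in>(\<Union>i\<in>I. A i). f a) \<le> (\<Sum>i\<in>I. \<Sum>a\<in>A i. f a)"
  using assms
proof (induction I rule: finite_induct)
  case (insert i I)
  have "(\<Sum>a\<in>A i \<union> (\<Union>i\<in>I. A i). f a) \<le> (\<Sum>a\<in>A i. f a) + (\<Sum>a\<in>(\<Union>i\<in>I. A i). f a)"
    using insert by (subst sum_Un) (auto intro!: sum_nonneg)
  then show ?case using insert by (simp add: order_trans[OF _ add_left_mono])
qed simp

text \<open>Four quarter turns suffice, since one of the real and imaginary parts carries at least
  half of the modulus. The sectors overlap, which is harmless for upper bounds.\<close>

lemma exists_sector: "\<exists>r<4. Re (\<i> ^ r * c) \<ge> cmod c / 2"
proof -
  have "cmod c \<le> \<bar>Re c\<bar> + \<bar>Im c\<bar>" by (rule cmod_le)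
  then consider "Re c \<ge> cmod c / 2" | "- Re c \<ge> cmod c / 2" | "Im c \<ge> cmod c / 2" | "- Im c \<ge> cmod c / 2"
    by linarith
  then show ?thesis
  proof cases
    case 1 then show ?thesis by (intro exI[of _ 0]) auto
  next
    case 2 then show ?thesis by (intro exI[of _ 2]) auto
  next
    case 3 then show ?thesis by (intro exI[of _ 3]) (auto simp: power3_eq_cube)
  next
    case 4 then show ?thesis by (intro exI[of _ 1]) auto
  qed
qed

text \<open>For one sector \<open>r\<close>, the partial sums \<open>v r k\<close> over the cells
  have subset sums bounded by \<open>B\<close>, so their squared norms add up to at most
  \<open>4 * B\<^sup>2\<close>. The lower bound for clustered translates turns this into
  \<open>8 * B / L2_norm h\<close> for the mixed norm of that sector's coefficients; four sectors
  give 32.\<close>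

lemma cell_coefficients_bound:
  fixes h :: "real ^ 'd \<Rightarrow> complex"
  assumes h: "h \<in> L2" "L2_norm h > 0" and F: "finite F"
    and close: "\<And>a a'. cell s a = cell s a' \<Longrightarrow> L2_norm (\<lambda>x. translation a h x - translation a' h x) \<le> L2_norm h / 4"
    and B: "\<And>A. A \<subseteq> F \<Longrightarrow> L2_norm (\<lambda>x. \<Sum>a\<in>A. c a * translation a h x) \<le> B"
  shows "L2_set (\<lambda>k. \<Sum>a\<in>{a\<in>F. cell s a = k}. cmod (c a)) (cell s ` F) \<le> 32 * B / L2_norm h"
proof -
  let ?n = "L2_norm h"
  define S where "S r k = {a\<in>F. cell s a = k \<and> Re (\<i> ^ r * c a) \<ge> cmod (c a) / 2}" for r k
  define \<nu> where "\<nu> r k = (\<Sum>a\<in>S r k. cmod (c a))" for r k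
  define v where "v r k = (\<lambda>x. \<Sum>a\<in>S r k. c a * translation a h x)" for r k
  have S: "S r k \<subseteq> F" "finite (S r k)" for r k using F by (auto simp: S_def)
  have vL: "v r k \<in> L2" for r k
    unfolding v_def by (intro L2_sum L2_scale L2_translation h)
  have B0: "B \<ge> 0" using B[of "{}"] by (simp add: L2_norm_def)
  have low: "?n / 4 * \<nu> r k \<le> L2_norm (v r k)" for r k
    unfolding \<nu>_def v_def
    by (rule clustered_translates_lower_bound[where u="\<i> ^ r"])
      (use h S close in \<open>auto simp: S_def norm_power\<close>)
  have sq: "(\<Sum>k\<in>cell s ` F. (\<nu> r k)\<^sup>2) \<le> 64 * B\<^sup>2 / ?n\<^sup>2" for r
  proof -
    have "(\<Sum>k\<in>cell s ` F. (L2_norm (v r k))\<^sup>2) \<le> 4 * B\<^sup>2"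
    proof (rule sum_norm_power2_le_of_subset_sums)
      fix A assume A: "A \<subseteq> cell s ` F"
      have "finite A" using A F finite_subset by blast
      \<comment> \<open>Sets \<open>S r k\<close> of different cells are disjoint, so a union of
        cells is again a subset of \<open>F\<close> and the hypothesis on subset sums
        applies.\<close>
      then have "(\<lambda>x. \<Sum>k\<in>A. v r k x) = (\<lambda>x. \<Sum>a\<in>(\<Union>k\<in>A. S r k). c a * translation a h x)"
        unfolding v_def using S by (subst sum.UNION_disjoint) (auto simp: S_def)
      then show "L2_norm (\<lambda>x. \<Sum>k\<in>A. v r k x) \<le> B" using B[of "\<Union>k\<in>A. S r k"] S by auto
    qed (use F vL in auto)
    moreover have "(?n / 4)\<^sup>2 * (\<Sum>k\<in>cell s ` F. (\<nu> r k)\<^sup>2) \<le> (\<Sum>k\<in>cell s ` F. (L2_norm (v r k))\<^sup>2)"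
      unfolding sum_distrib_left power_mult_distrib[symmetric] using h
      by (intro sum_mono power_mono low) (auto simp: \<nu>_def intro!: sum_nonneg mult_nonneg_nonneg)
    ultimately have "(?n / 4)\<^sup>2 * (\<Sum>k\<in>cell s ` F. (\<nu> r k)\<^sup>2) \<le> 4 * B\<^sup>2" by linarith
    then show ?thesis using h by (simp add: field_simps)
  qed
  have one: "L2_set (\<nu> r) (cell s ` F) \<le> 8 * B / ?n" for r
    unfolding L2_set_def using sq[of r] B0 h
    by (intro real_le_lsqrt) (auto simp: power_mult_distrib power_divide intro!: sum_nonneg)
  have "(\<Sum>a\<in>{a\<in>F. cell s a = k}. cmod (c a)) \<le> \<nu> 0 k + (\<nu> 1 k + (\<nu> 2 k + \<nu> 3 k))" for k
  proof -
    have "{a\<in>F. cell s a = k} \<subseteq> (\<Union>r<4. S r k)" using exists_sector by (auto simp: S_def)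
    then have "(\<Sum>a\<in>{a\<in>F. cell s a = k}. cmod (c a)) \<le> (\<Sum>a\<in>(\<Union>r<4. S r k). cmod (c a))"
      using S by (intro sum_mono2) auto
    also have "\<dots> \<le> (\<Sum>r<4. \<nu> r k)"
      unfolding \<nu>_def by (rule sum_UN_le) (use S in auto)
    also have "\<dots> = \<nu> 0 k + (\<nu> 1 k + (\<nu> 2 k + \<nu> 3 k))" by (simp add: eval_nat_numeral)
    finally show ?thesis .
  qed
  then have "L2_set (\<lambda>k. \<Sum>a\<in>{a\<in>F. cell s a = k}. cmod (c a)) (cell s ` F) \<le>
      L2_set (\<lambda>k. \<nu> 0 k + (\<nu> 1 k + (\<nu> 2 k + \<nu> 3 k))) (cell s ` F)"
    by (intro L2_set_mono) (auto intro: sum_nonneg)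
  also have "\<dots> \<le> L2_set (\<nu> 0) (cell s ` F) + (L2_set (\<nu> 1) (cell s ` F) + (L2_set (\<nu> 2) (cell s ` F) + L2_set (\<nu> 3) (cell s ` F)))"
    by (intro order_trans[OF L2_set_triangle_ineq] add_mono order_refl)
  also have "\<dots> \<le> 32 * B / ?n" using one[of 0] one[of 1] one[of 2] one[of 3] by simp
  finally show ?thesis .
qed

text \<open>
  A uniform boundedness principle that does not need completeness of \<open>L2\<close>: the functions in \<open>U\<close>
  are dominated pointwise by \<open>g\<close>, so the series built from them converges pointwise.
\<close>

lemma gliding_hump:
  fixes q :: "'i \<Rightarrow> ('a::euclidean_space \<Rightarrow> complex) \<Rightarrow> real"
  assumes M: "closed_L2_subspace M" and g: "g \<in> L2"
    and U: "U \<subseteq> M" "\<And>u x. u \<in> U \<Longrightarrow> cmod (u x) \<le> cmod (g x)"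
    and tri: "\<And>i f f'. i \<in> I \<Longrightarrow> f \<in> M \<Longrightarrow> f' \<in> M \<Longrightarrow> q i (\<lambda>x. f x + f' x) \<le> q i f + q i f'"
    and scale: "\<And>i f c. i \<in> I \<Longrightarrow> f \<in> M \<Longrightarrow> q i (\<lambda>x. c * f x) = cmod c * q i f"
    and cont: "\<And>i f. i \<in> I \<Longrightarrow> f \<in> M \<Longrightarrow> q i f \<le> K i * L2_norm f"
    and fin: "\<And>i f. i \<in> I \<Longrightarrow> f \<in> M \<Longrightarrow> q i f \<le> P f"
  shows "\<exists>C. \<forall>i\<in>I. \<forall>u\<in>U. q i u \<le> C"
proof (rule ccontr)
  assume "\<not> ?thesis"
  then have unb: "\<exists>i\<in>I. \<exists>u\<in>U. q i u > C" for C by (meson not_le)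
  have Madd: "(\<lambda>x. f x + f' x) \<in> M" if "f \<in> M" "f' \<in> M" for f f'
    using M that by (simp add: closed_L2_subspace_def)
  have Mscale: "(\<lambda>x. c * f x) \<in> M" if "f \<in> M" for c f
    using M that by (simp add: closed_L2_subspace_def)
  have Mzero: "(\<lambda>x. 0) \<in> M" and ML2: "M \<subseteq> L2" using M by (auto simp: closed_L2_subspace_def)
  \<comment> \<open>All terms after the current one have norm at most
    \<open>2 * t' * L2_norm g\<close>, where \<open>t'\<close> is the next weight. So
    \<open>t' * L i \<le> 1\<close> keeps their contribution to \<open>q i\<close> below 1; the
    summand 1 keeps \<open>L i\<close> positive.\<close>
  define L where "L i = 2 * (\<bar>K i\<bar> * L2_norm g + 1)" for i
  have L: "L i > 0" for i unfolding L_def by (simp add: L2_norm_nonneg add_nonneg_pos)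
  \<comment> \<open>A state consists of the partial sum, the last weight and the last index. The new
    weight is chosen first, small against the old index; then the failing bound supplies an index
    and a member of \<open>U\<close> whose weighted hump exceeds the bound \<open>P w\<close> of the
    partial sum by at least \<open>n\<close>.\<close>
  define stp where "stp n = (\<lambda>(w, t, i) (w', t', i'). t' \<le> t / 2 \<and> t' * L i \<le> 1 \<and>
      (\<exists>u\<in>U. w' = (\<lambda>x. w x + complex_of_real t' * u x) \<and> t' * q i' u \<ge> real n + P w))"
     for n :: nat
  define ok where "ok = (\<lambda>(w :: 'a \<Rightarrow> complex, t :: real, i). w \<in> M \<and> t > 0 \<and> i \<in> I)"
  obtain i0 where i0: "i0 \<in> I" using unb by blast
  have "\<exists>f. \<forall>n. (ok (f n) \<and> (n = 0 \<longrightarrow> fst (f n) = (\<lambda>x. 0) \<and> fst (snd (f n)) = 1)) \<and> stp n (f n) (f (Suc n))"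
  proof (rule dependent_nat_choice[where
      P="\<lambda>n x. ok x \<and> (n = 0 \<longrightarrow> fst x = (\<lambda>x. 0) \<and> fst (snd x) = 1)" and Q=stp])
    show "\<exists>x. ok x \<and> ((0::nat) = 0 \<longrightarrow> fst x = (\<lambda>x. 0) \<and> fst (snd x) = 1)"
      using i0 Mzero by (intro exI[of _ "((\<lambda>x. 0), 1, i0)"]) (auto simp: ok_def)
  next
    fix x and n :: nat assume x: "ok x \<and> (n = 0 \<longrightarrow> fst x = (\<lambda>x. 0) \<and> fst (snd x) = 1)"
    obtain w t i where [simp]: "x = (w, t, i)" by (cases x) auto
    have wt: "w \<in> M" "t > 0" "i \<in> I" using x by (auto simp: ok_def)
    define t' where "t' = min (t / 2) (1 / L i)"
    have t': "t' > 0" "t' \<le> t / 2" "t' * L i \<le> 1"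
      using wt L[of i] by (auto simp: t'_def min_def field_simps)
    obtain i' u where u: "i' \<in> I" "u \<in> U" "q i' u > (real n + P w) / t'" using unb by blast
    then have "t' * q i' u \<ge> real n + P w" using t' by (simp add: field_simps)
    moreover have "(\<lambda>x. w x + complex_of_real t' * u x) \<in> M" using u U wt by (intro Madd Mscale) auto
    ultimately show "\<exists>y. (ok y \<and> (Suc n = 0 \<longrightarrow> fst y = (\<lambda>x. 0) \<and> fst (snd y) = 1)) \<and> stp n x y"
      using u t' by (intro exI[of _ "((\<lambda>x. w x + complex_of_real t' * u x), t', i')"]) (auto simp: ok_def stp_def)
  qed
  then obtain f where f: "\<And>n. ok (f n)" "fst (f 0) = (\<lambda>x. 0)" "fst (snd (f 0)) = 1" "\<And>n. stp n (f n) (f (Suc n))"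
    by auto
  define w t i where "w n = fst (f n)" and "t n = fst (snd (f n))" and "i n = snd (snd (f n))" for n
  have wM: "w n \<in> M" and tpos: "t n > 0" and iI: "i n \<in> I" for n
    using f(1)[of n] by (auto simp: ok_def w_def t_def i_def split: prod.splits)
  have w0: "w 0 = (\<lambda>x. 0)" and t0: "t 0 = 1" using f by (auto simp: w_def t_def)
  have step: "t (Suc n) \<le> t n / 2" "t (Suc n) * L (i n) \<le> 1"
    "\<exists>u\<in>U. w (Suc n) = (\<lambda>x. w n x + complex_of_real (t (Suc n)) * u x) \<and> t (Suc n) * q (i (Suc n)) u \<ge> real n + P (w n)" for n
    using f(4)[of n] by (auto simp: stp_def w_def t_def i_def split: prod.splits)
  obtain u where u: "\<And>n. u n \<in> U" "\<And>n. w (Suc n) = (\<lambda>x. w n x + complex_of_real (t (Suc n)) * u n x)"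
     "\<And>n. t (Suc n) * q (i (Suc n)) (u n) \<ge> real n + P (w n)"
    using step(3) by metis
  have t_le: "t n \<le> (1/2) ^ n" for n
    by (induction n) (use step(1) t0 in \<open>auto intro: order_trans\<close>)
  have t_lim: "t \<longlonglongrightarrow> 0"
    by (rule tendsto_sandwich[of "\<lambda>_. 0" _ _ "\<lambda>n. (1/2) ^ n"])
      (use t_le tpos in \<open>auto intro!: always_eventually LIMSEQ_power_zero intro: less_imp_le\<close>)
  \<comment> \<open>Since weights at least halve, each one is at most twice its drop to the next.
    The geometric tail then telescopes and the induction closes with an exact constant.\<close>
  have tel: "cmod (w m x - w n x) \<le> 2 * (t (Suc n) - t (Suc m)) * cmod (g x)" if "m \<ge> n" for m n x
    using that
  proof (induction m rule: dec_induct)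
    case base then show ?case by simp
  next
    case (step m)
    have "cmod (w (Suc m) x - w n x) \<le> cmod (w m x - w n x) + cmod (w (Suc m) x - w m x)"
      using norm_triangle_ineq[of "w m x - w n x" "w (Suc m) x - w m x"] by simp
    also have "cmod (w (Suc m) x - w m x) = t (Suc m) * cmod (u m x)"
      using tpos[of "Suc m"] by (simp add: u(2) norm_mult)
    also have "\<dots> \<le> t (Suc m) * cmod (g x)"
      using tpos[of "Suc m"] U(2)[OF u(1)] by (intro mult_left_mono) auto
    also have "t (Suc m) * cmod (g x) \<le> 2 * (t (Suc m) - t (Suc (Suc m))) * cmod (g x)"
      using \<open>\<And>n. t (Suc n) \<le> t n / 2\<close>[of "Suc m"] by (intro mult_right_mono) auto
    finally show ?case using step.IH by (simp add: algebra_simps)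
  qed
  then have tel': "cmod (w m x - w n x) \<le> 2 * t (Suc n) * cmod (g x)" if "m \<ge> n" for m n x
    using that tpos[of "Suc m"] mult_right_mono[of "2 * (t (Suc n) - t (Suc m))" "2 * t (Suc n)" "cmod (g x)"]
    by (smt (verit) norm_ge_zero)
  have "Cauchy (\<lambda>n. w n x)" for x
  proof (rule CauchyI)
    fix e :: real assume e: "e > 0"
    have "(\<lambda>n. 2 * t (Suc n) * cmod (g x)) \<longlonglongrightarrow> 2 * 0 * cmod (g x)"
      by (intro tendsto_intros LIMSEQ_Suc t_lim)
    then have "\<forall>\<^sub>F n in sequentially. 2 * t (Suc n) * cmod (g x) < e / 2"
      by (rule order_tendstoD) (use e in auto)
    then obtain N where N: "2 * t (Suc N) * cmod (g x) < e / 2" by (auto simp: eventually_sequentially)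
    have "cmod (w m x - w n x) < e" if "m \<ge> N" "n \<ge> N" for m n
      using tel'[OF that(1), of x] tel'[OF that(2), of x] N norm_triangle_ineq4[of "w m x - w N x" "w n x - w N x"] by simp
    then show "\<exists>M. \<forall>m\<ge>M. \<forall>n\<ge>M. cmod (w m x - w n x) < e" by blast
  qed
  then have conv: "(\<lambda>n. w n x) \<longlonglongrightarrow> lim (\<lambda>n. w n x)" for x
    by (simp add: Cauchy_convergent_iff convergent_LIMSEQ_iff)
  define F where "F x = lim (\<lambda>n. w n x)" for x
  have dist: "cmod (w n x - F x) \<le> (2 * t (Suc n)) * cmod (g x)" for n x
  proof -
    have "(\<lambda>m. cmod (w m x - w n x)) \<longlonglongrightarrow> cmod (F x - w n x)"
      unfolding F_def by (intro tendsto_intros conv)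
    then have "cmod (F x - w n x) \<le> (2 * t (Suc n)) * cmod (g x)"
      using tel'[of n _ x] by (intro LIMSEQ_le_const2) auto
    then show ?thesis by (simp add: norm_minus_commute)
  qed
  have wL: "w n \<in> L2" for n using wM ML2 by auto
  have Fm[measurable]: "F \<in> borel_measurable borel"
    by (rule borel_measurable_LIMSEQ_metric[of w]) (use wL conv in \<open>auto simp: F_def intro: L2_borel\<close>)
  have FL: "F \<in> L2"
    by (rule L2_bounded_by[OF g, of _ "2 * t 1"]) (use dist[of 0] w0 in auto)
  have nd: "L2_norm (\<lambda>x. w n x - F x) \<le> 2 * t (Suc n) * L2_norm g" for n
    by (rule L2_norm_mono[OF L2_diff[OF wL FL] g dist]) (use tpos[of "Suc n"] in auto)
  have "(\<lambda>n. L2_norm (\<lambda>x. w n x - F x)) \<longlonglongrightarrow> 0"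
  proof (rule tendsto_sandwich[of "\<lambda>_. 0" _ _ "\<lambda>n. 2 * t (Suc n) * L2_norm g"])
    have "(\<lambda>n. 2 * t (Suc n) * L2_norm g) \<longlonglongrightarrow> 2 * 0 * L2_norm g"
      by (intro tendsto_intros LIMSEQ_Suc t_lim)
    then show "(\<lambda>n. 2 * t (Suc n) * L2_norm g) \<longlonglongrightarrow> 0" by simp
  qed (use nd in \<open>auto simp: L2_norm_nonneg\<close>)
  then have FM: "F \<in> M" using M FL wM unfolding closed_L2_subspace_def by blast
  \<comment> \<open>The hump is the difference of two consecutive partial sums. The earlier one
    costs \<open>P (w n)\<close>, which the choice of the hump has already compensated; the later
    one differs from the limit \<open>F\<close> by a tail of size at most 1 in
    \<open>q ?i\<close>.\<close>
  have "real n \<le> P F + 1" for n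
  proof -
    let ?i = "i (Suc n)"
    have mw: "(\<lambda>x. - 1 * w n x) \<in> M" and mF: "(\<lambda>x. - 1 * F x) \<in> M" by (intro Mscale wM FM)+
    have "real n + P (w n) \<le> t (Suc n) * q ?i (u n)" by (rule u(3))
    also have "\<dots> = q ?i (\<lambda>x. complex_of_real (t (Suc n)) * u n x)"
      using u(1) U(1) iI tpos[of "Suc n"] by (subst scale) auto
    also have "(\<lambda>x. complex_of_real (t (Suc n)) * u n x) = (\<lambda>x. w (Suc n) x + - 1 * w n x)"
      by (simp add: u(2))
    also have "q ?i \<dots> \<le> q ?i (w (Suc n)) + q ?i (\<lambda>x. - 1 * w n x)"
      by (rule tri[OF iI wM mw])
    also have "q ?i (\<lambda>x. - 1 * w n x) = q ?i (w n)" using scale[OF iI wM, of "Suc n" "-1" n] by simp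
    also have "\<dots> \<le> P (w n)" by (rule fin[OF iI wM])
    also have "q ?i (w (Suc n)) \<le> P F + 1"
    proof -
      have "q ?i (\<lambda>x. F x + (w (Suc n) x + - 1 * F x)) \<le> q ?i F + q ?i (\<lambda>x. w (Suc n) x + - 1 * F x)"
        by (intro tri iI FM Madd wM mF)
      also have "q ?i F \<le> P F" by (rule fin[OF iI FM])
      also have "q ?i (\<lambda>x. w (Suc n) x + - 1 * F x) \<le> K ?i * L2_norm (\<lambda>x. w (Suc n) x + - 1 * F x)"
        by (intro cont iI Madd wM mF)
      also have "\<dots> \<le> \<bar>K ?i\<bar> * (2 * t (Suc (Suc n)) * L2_norm g)"
        using nd[of "Suc n"] by (intro mult_mono) (auto simp: L2_norm_nonneg)
      also have "\<dots> \<le> t (Suc (Suc n)) * L ?i"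
        unfolding L_def using tpos[of "Suc (Suc n)"] by (simp add: algebra_simps)
      also have "\<dots> \<le> 1" by (rule step(2))
      finally show ?thesis by simp
    qed
    finally show ?thesis by simp
  qed
  then show False using reals_Archimedean2[of "P F + 1"] by (meson not_le)
qed

text \<open>Beyond some finite \<open>F0\<close> all partial sums are within 1 of \<open>f\<close>.
  An arbitrary \<open>A\<close> is \<open>A \<union> F0\<close> without \<open>F0 - A\<close>, and
  the latter is one of the finitely many subsets of \<open>F0\<close>.\<close>

lemma L2_has_sum_bounded_partial_sums:
  assumes "L2_has_sum u f I" and u: "\<And>i. i \<in> I \<Longrightarrow> u i \<in> L2" and f: "f \<in> L2"
  shows "\<exists>B. \<forall>A. finite A \<and> A \<subseteq> I \<longrightarrow> L2_norm (\<lambda>x. \<Sum>i\<in>A. u i x) \<le> B"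
proof -
  have "\<forall>\<^sub>F F in finite_subsets_at_top I. L2_norm (\<lambda>t. (\<Sum>i\<in>F. u i t) - f t) < 1"
    using assms(1) unfolding L2_has_sum_def by (rule order_tendstoD) simp
  then obtain F0 where F0: "finite F0" "F0 \<subseteq> I"
    "\<And>F. finite F \<Longrightarrow> F0 \<subseteq> F \<Longrightarrow> F \<subseteq> I \<Longrightarrow> L2_norm (\<lambda>t. (\<Sum>i\<in>F. u i t) - f t) < 1"
    by (auto simp: eventually_finite_subsets_at_top)
  show ?thesis
  proof (intro exI[of _ "(1 + L2_norm f) + (\<Sum>i\<in>F0. L2_norm (u i))"] allI impI)
    fix A assume A: "finite A \<and> A \<subseteq> I"
    have uA: "(\<lambda>x. \<Sum>i\<in>B. u i x) \<in> L2" if "B \<subseteq> I" for B using that u by (intro L2_sum) auto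
    have eq: "(\<lambda>x. \<Sum>i\<in>A. u i x) = (\<lambda>x. ((\<Sum>i\<in>A \<union> F0. u i x) - f x + f x) - (\<Sum>i\<in>F0 - A. u i x))"
    proof
      fix x
      have "(\<Sum>i\<in>A \<union> F0. u i x) = (\<Sum>i\<in>A. u i x) + (\<Sum>i\<in>F0 - A. u i x)"
        using A F0 by (subst sum.union_disjoint[symmetric]) (auto intro!: sum.cong)
      then show "(\<Sum>i\<in>A. u i x) = ((\<Sum>i\<in>A \<union> F0. u i x) - f x + f x) - (\<Sum>i\<in>F0 - A. u i x)" by simp
    qed
    have "L2_norm (\<lambda>x. \<Sum>i\<in>A. u i x) \<le> L2_norm (\<lambda>x. (\<Sum>i\<in>A \<union> F0. u i x) - f x + f x) + L2_norm (\<lambda>x. \<Sum>i\<in>F0 - A. u i x)"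
      by (subst eq) (use A F0 f in \<open>intro L2_norm_triangle_diff L2_add L2_diff uA; auto\<close>)
    also have "L2_norm (\<lambda>x. (\<Sum>i\<in>A \<union> F0. u i x) - f x + f x) \<le> L2_norm (\<lambda>x. (\<Sum>i\<in>A \<union> F0. u i x) - f x) + L2_norm f"
      by (rule L2_norm_triangle) (use A F0 f in \<open>intro L2_diff uA; auto\<close>, rule f)
    also have "L2_norm (\<lambda>x. (\<Sum>i\<in>A \<union> F0. u i x) - f x) \<le> 1"
      by (rule less_imp_le[OF F0(3)]) (use A F0 in auto)
    also have "L2_norm (\<lambda>x. \<Sum>i\<in>F0 - A. u i x) \<le> (\<Sum>i\<in>F0 - A. L2_norm (u i))"
      using F0 u by (intro L2_norm_sum_le) auto
    also have "\<dots> \<le> (\<Sum>i\<in>F0. L2_norm (u i))"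
      using F0 by (intro sum_mono2) (auto simp: L2_norm_nonneg)
    finally show "L2_norm (\<lambda>x. \<Sum>i\<in>A. u i x) \<le> 1 + L2_norm f + (\<Sum>i\<in>F0. L2_norm (u i))" by simp
  qed
qed

text \<open>The gliding hump is applied to the mixed norms of the coefficients, one seminorm for
  each finite \<open>F\<close>. They are continuous with a constant depending on \<open>F\<close>,
  and bounded in \<open>F\<close> for each fixed \<open>f\<close> by
  \<open>cell_coefficients_bound\<close>.\<close>

lemma uniform_cell_coefficients_bound:
  fixes h g :: "real ^ 'd \<Rightarrow> complex" and y :: "real ^ 'd \<Rightarrow> real ^ 'd \<Rightarrow> complex"
  assumes M: "closed_L2_subspace M" and g: "g \<in> L2"
    and U: "U \<subseteq> M" "\<And>u x. u \<in> U \<Longrightarrow> cmod (u x) \<le> cmod (g x)"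
    and h: "h \<in> L2" "L2_norm h > 0" and y: "\<And>a. a \<in> \<Lambda> \<Longrightarrow> y a \<in> L2"
    and B: "\<And>f. f \<in> M \<Longrightarrow> \<exists>B. \<forall>A. finite A \<and> A \<subseteq> \<Lambda> \<longrightarrow> L2_norm (\<lambda>x. \<Sum>a\<in>A. L2_inner f (y a) * translation a h x) \<le> B"
    and close: "\<And>a a'. cell s a = cell s a' \<Longrightarrow> L2_norm (\<lambda>x. translation a h x - translation a' h x) \<le> L2_norm h / 4"
  shows "\<exists>C. \<forall>u\<in>U. \<forall>F. finite F \<and> F \<subseteq> \<Lambda> \<longrightarrow>
    L2_set (\<lambda>k. \<Sum>a\<in>{a\<in>F. cell s a = k}. cmod (L2_inner u (y a))) (cell s ` F) \<le> C"
proof -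
  define q where "q F f = L2_set (\<lambda>k. \<Sum>a\<in>{a\<in>F. cell s a = k}. cmod (L2_inner f (y a))) (cell s ` F)" for F f
  have ML2: "M \<subseteq> L2" using M by (simp add: closed_L2_subspace_def)
  have "\<forall>f\<in>M. \<exists>B. \<forall>A. finite A \<and> A \<subseteq> \<Lambda> \<longrightarrow> L2_norm (\<lambda>x. \<Sum>a\<in>A. L2_inner f (y a) * translation a h x) \<le> B"
    using B by (rule ballI)
  from bchoice[OF this] obtain B' where B': "\<And>f A. f \<in> M \<Longrightarrow> finite A \<Longrightarrow> A \<subseteq> \<Lambda> \<Longrightarrow> L2_norm (\<lambda>x. \<Sum>a\<in>A. L2_inner f (y a) * translation a h x) \<le> B' f"
    by auto
  have "\<exists>C. \<forall>F\<in>{F. finite F \<and> F \<subseteq> \<Lambda>}. \<forall>u\<in>U. q F u \<le> C"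
  proof (rule gliding_hump[where M=M and g=g and K="\<lambda>F. \<Sum>a\<in>F. L2_norm (y a)" and P="\<lambda>f. 32 * B' f / L2_norm h"])
    show "closed_L2_subspace M" "g \<in> L2" "U \<subseteq> M" by fact+
    show "cmod (u x) \<le> cmod (g x)" if "u \<in> U" for u x by (rule U(2)[OF that])
  next
    fix F f f' assume F: "F \<in> {F. finite F \<and> F \<subseteq> \<Lambda>}" and f: "f \<in> M" "f' \<in> M"
    have "(\<Sum>a\<in>{a\<in>F. cell s a = k}. cmod (L2_inner (\<lambda>x. f x + f' x) (y a))) \<le>
      (\<Sum>a\<in>{a\<in>F. cell s a = k}. cmod (L2_inner f (y a))) + (\<Sum>a\<in>{a\<in>F. cell s a = k}. cmod (L2_inner f' (y a)))" for k
      unfolding sum.distrib[symmetric] using F f ML2 y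
      by (intro sum_mono) (subst L2_inner_add_left, auto intro: norm_triangle_ineq)
    then show "q F (\<lambda>x. f x + f' x) \<le> q F f + q F f'"
      unfolding q_def by (intro order_trans[OF L2_set_mono L2_set_triangle_ineq]) (auto intro: sum_nonneg)
  next
    fix F f c
    show "q F (\<lambda>x. c * f x) = cmod c * q F f"
      unfolding q_def by (simp add: L2_inner_scale_left norm_mult L2_set_right_distrib flip: sum_distrib_left)
  next
    fix F f assume F: "F \<in> {F. finite F \<and> F \<subseteq> \<Lambda>}" and f: "f \<in> M"
    have "q F f \<le> (\<Sum>k\<in>cell s ` F. \<Sum>a\<in>{a\<in>F. cell s a = k}. cmod (L2_inner f (y a)))"
      unfolding q_def by (intro L2_set_le_sum sum_nonneg) auto
    also have "\<dots> = (\<Sum>a\<in>F. cmod (L2_inner f (y a)))" using F by (intro sum_over_fibres) auto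
    also have "\<dots> \<le> (\<Sum>a\<in>F. L2_norm f * L2_norm (y a))"
      using F f ML2 y by (intro sum_mono L2_Cauchy_Schwarz) auto
    finally show "q F f \<le> (\<Sum>a\<in>F. L2_norm (y a)) * L2_norm f" by (simp add: sum_distrib_left[symmetric] mult.commute)
    show "q F f \<le> 32 * B' f / L2_norm h"
      unfolding q_def using F by (intro cell_coefficients_bound[OF h _ close] B' f) (auto intro: finite_subset)
  qed
  then show ?thesis unfolding q_def by blast
qed

text \<open>Hoelder's inequality for the mixed norms: the coefficients stay bounded in l^1 inside
  cells and l^2 over cells, uniformly in \<open>n\<close>, while the suprema of the pairings over
  cells tend to 0 in l^2.\<close>

lemma pairing_with_modulations_tendsto_0:
  fixes \<psi> h g :: "real ^ 'd \<Rightarrow> complex" and y :: "real ^ 'd \<Rightarrow> real ^ 'd \<Rightarrow> complex" and b :: "nat \<Rightarrow> real ^ 'd"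
  assumes \<psi>: "schwartz \<psi>" "\<psi> \<noteq> (\<lambda>x. 0)" and g: "g \<in> feichtinger_algebra \<psi>" and M: "closed_L2_subspace M"
    and h: "h \<in> L2" and y: "\<And>a. a \<in> \<Lambda> \<Longrightarrow> y a \<in> L2"
    and B: "\<And>f. f \<in> M \<Longrightarrow> \<exists>B. \<forall>A. finite A \<and> A \<subseteq> \<Lambda> \<longrightarrow> L2_norm (\<lambda>x. \<Sum>a\<in>A. L2_inner f (y a) * translation a h x) \<le> B"
    and b: "\<And>n. modulation (b n) g \<in> M" "filterlim (\<lambda>n. norm (b n)) at_top sequentially" and e: "e > 0"
  shows "\<forall>\<^sub>F n in sequentially. \<forall>F. finite F \<and> F \<subseteq> \<Lambda> \<longrightarrow>
    (\<Sum>a\<in>F. cmod (L2_inner (modulation (b n) g) (y a)) * cmod (L2_inner (translation a h) (modulation (b n) g))) \<le> e"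
proof (cases "L2_norm h = 0")
  \<comment> \<open>Closeness of translates is measured relative to the norm of \<open>h\<close>, so
    a null \<open>h\<close> is treated apart; all its pairings vanish.\<close>
  case True
  have gL: "g \<in> L2" using g by (simp add: feichtinger_algebra_def)
  have "L2_inner (translation a h) (modulation (b n) g) = 0" for a n
    using L2_Cauchy_Schwarz[OF L2_translation[OF h, of a] L2_modulation[OF gL, of "b n"]] True
    by (simp add: L2_norm_translation[OF h])
  then show ?thesis using e by simp
next
  case False
  have gL: "g \<in> L2" using g by (simp add: feichtinger_algebra_def)
  have hpos: "L2_norm h > 0" using False L2_norm_nonneg[of h] by simp
  obtain d where d: "d > 0" "\<And>a. norm a < d \<Longrightarrow> L2_norm (\<lambda>x. translation a h x - h x) \<le> L2_norm h / 4"
    using translation_continuous_L2[OF h, of "L2_norm h / 4"] hpos by auto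
  obtain s0 where s0: "s0 > 0" "\<And>s. 0 < s \<Longrightarrow> s \<le> s0 \<Longrightarrow> (\<exists>G :: int ^ 'd \<Rightarrow> ennreal.
    (\<integral>\<^sup>+k. G k \<partial>count_space UNIV) < \<infinity> \<and> (AE x in lborel. ennreal (cmod (g x)) \<le> G (cell s x)))"
    using feichtinger_algebra_amalgam[OF \<psi> g] by auto
  \<comment> \<open>One cell size for both purposes: \<open>s0\<close> provides the local bound of
    \<open>g\<close>, and \<open>d\<close> makes translates of \<open>h\<close> from one cell nearly
    parallel.\<close>
  define s where "s = min s0 (d / real CARD('d))"
  have s: "s > 0" "s \<le> s0" "s * real CARD('d) \<le> d"
    using s0 d by (auto simp: s_def min_def field_simps)
  obtain G :: "int ^ 'd \<Rightarrow> ennreal" where G: "(\<integral>\<^sup>+k. G k \<partial>count_space UNIV) < \<infinity>"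
     "AE x in lborel. ennreal (cmod (g x)) \<le> G (cell s x)"
    using s0(2)[OF s(1,2)] by auto
  have close: "L2_norm (\<lambda>x. translation a h x - translation a' h x) \<le> L2_norm h / 4" if "cell s a = cell s a'" for a a'
    unfolding L2_norm_translation_diff[OF h] by (intro d norm_diff_less_of_cell_eq[OF s(1,3) that])
  have "\<exists>C. \<forall>u\<in>range (\<lambda>n. modulation (b n) g). \<forall>F. finite F \<and> F \<subseteq> \<Lambda> \<longrightarrow>
    L2_set (\<lambda>k. \<Sum>a\<in>{a\<in>F. cell s a = k}. cmod (L2_inner u (y a))) (cell s ` F) \<le> C"
    using b(1) by (intro uniform_cell_coefficients_bound[OF M gL _ _ h hpos y B close]) auto
  then obtain C where C: "\<And>n F. finite F \<Longrightarrow> F \<subseteq> \<Lambda> \<Longrightarrow>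
    L2_set (\<lambda>k. \<Sum>a\<in>{a\<in>F. cell s a = k}. cmod (L2_inner (modulation (b n) g) (y a))) (cell s ` F) \<le> C"
    by auto
  have C0: "C \<ge> 0" using C[of "{}"] by simp
  let ?E = "\<lambda>n k. SUP a\<in>{a. cell s a = k}. ennreal (cmod (L2_inner (translation a h) (modulation (b n) g)))"
  define r where "r = e / (C + 1)"
  have r: "r > 0" using e C0 by (simp add: r_def)
  have "(\<lambda>n. \<integral>\<^sup>+k. (?E n k)\<^sup>2 \<partial>count_space UNIV) \<longlonglongrightarrow> 0"
    by (rule sup_inner_modulation_tendsto_0[OF s(1) gL h G b(2)])
  then have "\<forall>\<^sub>F n in sequentially. (\<integral>\<^sup>+k. (?E n k)\<^sup>2 \<partial>count_space UNIV) < ennreal (r\<^sup>2)"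
    by (rule order_tendstoD) (use r in auto)
  then show ?thesis
  proof eventually_elim
    case (elim n)
    show ?case
    proof (intro allI impI)
      fix F assume F: "finite F \<and> F \<subseteq> \<Lambda>"
      let ?c = "\<lambda>a. cmod (L2_inner (modulation (b n) g) (y a))"
      let ?p = "\<lambda>a. cmod (L2_inner (translation a h) (modulation (b n) g))"
      \<comment> \<open>The maximum is evaluated only on cells that meet \<open>F\<close>, where it
        is attained and hence bounded by the supremum over the whole cell.\<close>
      define m where "m k = Max (?p ` {a\<in>F. cell s a = k})" for k
      have m: "?p a \<le> m (cell s a)" if "a \<in> F" for a
        unfolding m_def using that F by (intro Max_ge) auto
      have m_sup: "ennreal (m k) \<le> ?E n k" and m0: "m k \<ge> 0" if "k \<in> cell s ` F" for k
      proof -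
        have "m k \<in> ?p ` {a\<in>F. cell s a = k}"
          unfolding m_def using that F by (intro Max_in) auto
        then obtain a where a: "m k = ?p a" "cell s a = k" by auto
        show "ennreal (m k) \<le> ?E n k" unfolding a(1) by (rule SUP_upper) (use a in auto)
        show "m k \<ge> 0" by (simp add: a)
      qed
      have "ennreal (\<Sum>k\<in>cell s ` F. (m k)\<^sup>2) = (\<Sum>k\<in>cell s ` F. (ennreal (m k))\<^sup>2)"
        by (simp add: m0 ennreal_power flip: sum_ennreal)
      also have "\<dots> \<le> (\<Sum>k\<in>cell s ` F. (?E n k)\<^sup>2)"
        by (intro sum_mono power_mono m_sup) auto
      also have "\<dots> = (\<integral>\<^sup>+k. (?E n k)\<^sup>2 \<partial>count_space (cell s ` F))"
        using F by (simp add: nn_integral_count_space_finite)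
      also have "\<dots> = (\<integral>\<^sup>+k. (?E n k)\<^sup>2 * indicator (cell s ` F) k \<partial>count_space UNIV)"
        by (rule nn_integral_count_space_indicator) simp
      also have "\<dots> \<le> (\<integral>\<^sup>+k. (?E n k)\<^sup>2 \<partial>count_space UNIV)"
        by (intro nn_integral_mono) (auto simp: indicator_def)
      also note elim
      finally have "(\<Sum>k\<in>cell s ` F. (m k)\<^sup>2) < r\<^sup>2" by (simp add: ennreal_less_iff sum_nonneg)
      then have mr: "L2_set m (cell s ` F) \<le> r"
        unfolding L2_set_def using r by (intro real_le_lsqrt) (auto intro: sum_nonneg)
      have "(\<Sum>a\<in>F. ?c a * ?p a) \<le> (\<Sum>a\<in>F. ?c a * m (cell s a))"
        by (intro sum_mono mult_left_mono m) auto
      also have "\<dots> = (\<Sum>k\<in>cell s ` F. \<Sum>a\<in>{a\<in>F. cell s a = k}. ?c a * m (cell s a))"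
        using F by (intro sum_over_fibres[symmetric]) auto
      also have "\<dots> = (\<Sum>k\<in>cell s ` F. (\<Sum>a\<in>{a\<in>F. cell s a = k}. ?c a) * m k)"
        unfolding sum_distrib_right by (intro sum.cong) auto
      also have "\<dots> \<le> L2_set (\<lambda>k. \<Sum>a\<in>{a\<in>F. cell s a = k}. ?c a) (cell s ` F) * L2_set m (cell s ` F)"
        by (rule order_trans[OF _ L2_set_mult_ineq]) (auto intro!: sum_mono simp: abs_mult m0 sum_nonneg)
      also have "\<dots> \<le> C * r"
        using F C0 by (intro mult_mono C mr) (auto simp: L2_set_nonneg)
      also have "\<dots> \<le> e" using C0 e by (simp add: r_def field_simps)
      finally show "(\<Sum>a\<in>F. ?c a * ?p a) \<le> e" .
    qed
  qed
qed

section \<open>Contradiction along an unbounded sequence of frequencies\<close>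

theorem theorem1p2:
  fixes \<psi> g :: "real ^ 'd \<Rightarrow> complex"
    and \<Gamma> :: "(real ^ 'd) set"
    and M :: "(real ^ 'd \<Rightarrow> complex) set"
  assumes "schwartz \<psi>" and "\<psi> \<noteq> (\<lambda>x. 0)"
    and "g \<in> feichtinger_algebra \<psi>" and "\<not> (AE x in lborel. g x = 0)"
    and "closed_L2_subspace M"
    and "infinite \<Gamma>" and "uniform_discrete \<Gamma>"
    and "\<And>b. b \<in> \<Gamma> \<Longrightarrow> modulation b g \<in> M"
  shows "\<not> (\<exists>(N::nat) (h :: nat \<Rightarrow> real ^ 'd \<Rightarrow> complex) (\<Lambda> :: nat \<Rightarrow> (real ^ 'd) set).
            (\<forall>i\<in>{1..N}. h i \<in> L2 \<and> countable (\<Lambda> i)) \<and>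
            unconditional_schauder_frame M (SIGMA i:{1..N}. \<Lambda> i) (\<lambda>(i, a). translation a (h i)))"
proof
  assume "\<exists>(N::nat) (h :: nat \<Rightarrow> real ^ 'd \<Rightarrow> complex) (\<Lambda> :: nat \<Rightarrow> (real ^ 'd) set).
            (\<forall>i\<in>{1..N}. h i \<in> L2 \<and> countable (\<Lambda> i)) \<and>
            unconditional_schauder_frame M (SIGMA i:{1..N}. \<Lambda> i) (\<lambda>(i, a). translation a (h i))"
  then obtain N :: nat and h :: "nat \<Rightarrow> real ^ 'd \<Rightarrow> complex" and \<Lambda> :: "nat \<Rightarrow> (real ^ 'd) set"
    where h: "\<And>i. i \<in> {1..N} \<Longrightarrow> h i \<in> L2"
      and frame: "unconditional_schauder_frame M (SIGMA i:{1..N}. \<Lambda> i) (\<lambda>(i, a). translation a (h i))"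
    by blast
  let ?I = "SIGMA i:{1..N}. \<Lambda> i" and ?x = "\<lambda>j :: nat \<times> (real ^ 'd). translation (snd j) (h (fst j))"
  have "\<exists>y. (\<forall>j\<in>?I. y j \<in> M) \<and> (\<forall>f\<in>M. L2_has_sum (\<lambda>j t. L2_inner f (y j) * ?x j t) f ?I)"
    using frame unfolding unconditional_schauder_frame_def case_prod_beta by (elim conjE)
  then obtain y where y: "\<forall>j\<in>?I. y j \<in> M" "\<forall>f\<in>M. L2_has_sum (\<lambda>j t. L2_inner f (y j) * ?x j t) f ?I"
    by (elim exE conjE)
  note yM = y(1)[rule_format] and expand = y(2)[rule_format]
  have gL: "g \<in> L2" using assms(3) by (simp add: feichtinger_algebra_def)
  have ML2: "M \<subseteq> L2" using assms(5) by (simp add: closed_L2_subspace_def)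
  have xL: "?x j \<in> L2" if "j \<in> ?I" for j using that h by (intro L2_translation) auto
  have gpos: "L2_norm g > 0" using assms(4) L2_norm_eq_0_iff[OF gL] L2_norm_nonneg[of g] by simp
  \<comment> \<open>A bounded uniformly discrete set in Euclidean space is finite.\<close>
  have "\<not> bounded \<Gamma>" using assms(6,7) uniform_discrete_finite_iff by blast
  then have "\<exists>b\<in>\<Gamma>. norm b > real n" for n unfolding bounded_iff by (meson not_le)
  then obtain b where b: "\<And>n. b n \<in> \<Gamma>" "\<And>n. norm (b n) > real n" by metis
  have b_lim: "filterlim (\<lambda>n. norm (b n)) at_top sequentially"
    by (rule filterlim_at_top_mono[OF filterlim_real_sequentially]) (intro always_eventually allI less_imp_le b(2))
  \<comment> \<open>Each of the \<open>N\<close> generators may contribute \<open>e\<close>, a total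
    of at most a quarter of the squared norm of \<open>g\<close>; \<open>Suc N\<close> avoids
    division by 0.\<close>
  define e where "e = (L2_norm g)\<^sup>2 / (4 * real (Suc N))"
  have e: "e > 0" using gpos by (simp add: e_def)
  have "\<forall>\<^sub>F n in sequentially. \<forall>F. finite F \<and> F \<subseteq> \<Lambda> i \<longrightarrow>
    (\<Sum>a\<in>F. cmod (L2_inner (modulation (b n) g) (y (i, a))) * cmod (L2_inner (translation a (h i)) (modulation (b n) g))) \<le> e"
    if i: "i \<in> {1..N}" for i
  proof (rule pairing_with_modulations_tendsto_0[OF assms(1,2,3,5) h[OF i] _ _ _ b_lim e])
    show "y (i, a) \<in> L2" if "a \<in> \<Lambda> i" for a using subsetD[OF ML2 yM[of "(i, a)"]] that i by simp
    show "modulation (b n) g \<in> M" for n by (rule assms(8)[OF b(1)])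
    fix f assume f: "f \<in> M"
    \<comment> \<open>Unconditional convergence bounds all subset sums, in particular those that
      involve a single generator \<open>h i\<close>.\<close>
    have "\<exists>B. \<forall>A. finite A \<and> A \<subseteq> ?I \<longrightarrow> L2_norm (\<lambda>x. \<Sum>j\<in>A. L2_inner f (y j) * ?x j x) \<le> B"
      by (rule L2_has_sum_bounded_partial_sums[OF expand[OF f]])
        (rule L2_scale[OF xL], assumption, rule subsetD[OF ML2 f])
    then obtain B where B: "\<forall>A. finite A \<and> A \<subseteq> ?I \<longrightarrow> L2_norm (\<lambda>x. \<Sum>j\<in>A. L2_inner f (y j) * ?x j x) \<le> B"
      by (rule exE)
    show "\<exists>B. \<forall>A. finite A \<and> A \<subseteq> \<Lambda> i \<longrightarrow> L2_norm (\<lambda>x. \<Sum>a\<in>A. L2_inner f (y (i, a)) * translation a (h i) x) \<le> B"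
    proof (intro exI[of _ B] allI impI)
      fix A assume A: "finite A \<and> A \<subseteq> \<Lambda> i"
      have "(\<lambda>x. \<Sum>a\<in>A. L2_inner f (y (i, a)) * translation a (h i) x) = (\<lambda>x. \<Sum>j\<in>Pair i ` A. L2_inner f (y j) * ?x j x)"
        by (subst sum.reindex) (auto simp: inj_on_def)
      moreover have "finite (Pair i ` A)" "Pair i ` A \<subseteq> ?I" using A i by auto
      ultimately show "L2_norm (\<lambda>x. \<Sum>a\<in>A. L2_inner f (y (i, a)) * translation a (h i) x) \<le> B"
        using B by simp
    qed
  qed
  then have "\<forall>\<^sub>F n in sequentially. \<forall>i\<in>{1..N}. \<forall>F. finite F \<and> F \<subseteq> \<Lambda> i \<longrightarrow>
    (\<Sum>a\<in>F. cmod (L2_inner (modulation (b n) g) (y (i, a))) * cmod (L2_inner (translation a (h i)) (modulation (b n) g))) \<le> e"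
    by (intro eventually_ball_finite) auto
  from eventually_happens'[OF sequentially_bot this]
  obtain n where n: "\<And>i F. i \<in> {1..N} \<Longrightarrow> finite F \<Longrightarrow> F \<subseteq> \<Lambda> i \<Longrightarrow>
    (\<Sum>a\<in>F. cmod (L2_inner (modulation (b n) g) (y (i, a))) * cmod (L2_inner (translation a (h i)) (modulation (b n) g))) \<le> e"
    by fast
  define f where "f = modulation (b n) g"
  have fM: "f \<in> M" and fL: "f \<in> L2" and fg: "L2_norm f = L2_norm g"
    using assms(8)[OF b(1)[of n]] ML2 by (auto simp: f_def)
  \<comment> \<open>Only now, with \<open>n\<close> fixed, is the expansion truncated. Within half
    the norm of \<open>g\<close>, the partial sum still pairs with \<open>f\<close> to at least half
    the squared norm, whereas the choice of \<open>e\<close> allows at most a quarter.\<close>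
  have "\<forall>\<^sub>F F in finite_subsets_at_top ?I. L2_norm (\<lambda>t. (\<Sum>j\<in>F. L2_inner f (y j) * ?x j t) - f t) < L2_norm g / 2"
    using expand[OF fM] unfolding L2_has_sum_def by (rule order_tendstoD) (use gpos in simp)
  then obtain F where F: "finite F" "F \<subseteq> ?I" "L2_norm (\<lambda>t. (\<Sum>j\<in>F. L2_inner f (y j) * ?x j t) - f t) < L2_norm g / 2"
    by (auto simp: eventually_finite_subsets_at_top)
  let ?w = "\<lambda>t. \<Sum>j\<in>F. L2_inner f (y j) * ?x j t"
  have wL: "?w \<in> L2" using F xL by (intro L2_sum L2_scale) auto
  have "cmod (L2_inner ?w f - L2_inner f f) \<le> L2_norm (\<lambda>t. ?w t - f t) * L2_norm f"
    unfolding L2_inner_diff_left[OF wL fL fL, symmetric] by (intro L2_Cauchy_Schwarz L2_diff wL fL)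
  also have "\<dots> \<le> L2_norm g / 2 * L2_norm g" unfolding fg using F(3) gpos by (intro mult_right_mono) auto
  finally have 1: "(L2_norm g)\<^sup>2 - cmod (L2_inner ?w f) \<le> (L2_norm g)\<^sup>2 / 2"
    using norm_triangle_ineq2[of "L2_inner f f" "L2_inner ?w f"]
    by (simp add: L2_inner_self fg norm_minus_commute power2_eq_square norm_mult)
  define F' where "F' i = {a. (i, a) \<in> F}" for i
  have F': "finite (F' i)" "F' i \<subseteq> \<Lambda> i" for i
  proof -
    have "F' i \<subseteq> snd ` F" by (force simp: F'_def)
    then show "finite (F' i)" using F(1) finite_subset by blast
    show "F' i \<subseteq> \<Lambda> i" using F(2) by (auto simp: F'_def)
  qed
  have Feq: "F = (SIGMA i:{1..N}. F' i)" using F(2) by (auto simp: F'_def)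
  have "cmod (L2_inner ?w f) = cmod (\<Sum>j\<in>F. L2_inner f (y j) * L2_inner (?x j) f)"
    using F xL fL by (subst L2_inner_sum_left) (auto simp: L2_inner_scale_left intro: L2_scale)
  also have "\<dots> \<le> (\<Sum>j\<in>F. cmod (L2_inner f (y j)) * cmod (L2_inner (?x j) f))"
    by (rule order_trans[OF norm_sum]) (simp add: norm_mult)
  also have "\<dots> = (\<Sum>i\<in>{1..N}. \<Sum>a\<in>F' i. cmod (L2_inner f (y (i, a))) * cmod (L2_inner (translation a (h i)) f))"
    using F' by (subst Feq, subst sum.Sigma) (auto simp: case_prod_beta)
  also have "\<dots> \<le> (\<Sum>i\<in>{1..N}. e)"
    unfolding f_def by (intro sum_mono n F')
  also have "\<dots> = real N * e" by simp
  also have "\<dots> \<le> (L2_norm g)\<^sup>2 / 4" using gpos by (simp add: e_def field_simps)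
  finally have "(L2_norm g)\<^sup>2 \<le> 0" using 1 by linarith
  then show False using gpos by simp
qed

end
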